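(* Let $\sigma$ be a spectral function. The space $(L_\sigma^*,\|\cdot\|_\sigma^* )$ is the dual of $(L_\sigma,\|\cdot\|_\sigma)$, under the pairing $(Y,Z)\mapsto\mathbb{E}\,YZ$: the map sending $Z\in L_\sigma^*$ to the functional $Y\mapsto\mathbb{E}\,YZ$ is a linear bijection of $L_\sigma^*$ onto the space of continuous linear functionals on $(L_\sigma,\|\cdot\|_\sigma)$, and $\|Z\|_\sigma^*$ is the operator norm of this functional.
   Context: Let $(\Omega,\mathcal{F},P)$ be a probability space and $L^0$ the space of real-valued random variables, identified when almost surely equal; $L^1=L^1(\Omega,\mathcal{F},P)$. A spectral function is a nondecreasing function $\sigma:[0,1)\to[0,\infty)$ with $\int_0^1\sigma(u)\,du=1$. For a random variable $Y$ and $0<u<1$ let $F_Y^{-1}(u):=\inf\{y:P(Y\le y)\ge u\}$, and let $\rho_\sigma(Y):=\int_0^1\sigma(u)F_Y^{-1}(u)\,du$ when the integral exists. Put $\|Y\|_\sigma:=\rho_\sigma(|Y|)\in[0,\infty]$ for $Y\in L^0$ and $L_\sigma:=\{Y\in L^0:\|Y\|_\sigma<\infty\}$. For $0\le\alpha<1$ the Average Value-at-Risk is $\mathrm{AV@R}_\alpha(Y):=\frac{1}{1-\alpha}\int_\alpha^1F_Y^{-1}(u)\,du$. For $Z\in L^1$ put $$\|Z\|_\sigma^*:=\inf\Big\{\eta\ge0:\ \mathrm{AV@R}_\alpha(|Z|)\le\frac{\eta}{1-\alpha}\int_\alpha^1\sigma(u)\,du\ \text{ for all }0\le\alpha<1\Big\}$$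 (with $\inf\emptyset=\infty$), and $L_\sigma^*:=\{Z\in L^1:\|Z\|_\sigma^*<\infty\}$. *)

theory Defs
  imports "HOL-Probability.Probability"
begin

section \<open>Random variables modulo almost sure equality\<close>

definition ae_rel :: "'a measure \<Rightarrow> (('a \<Rightarrow> real) \<times> ('a \<Rightarrow> real)) set" where
  "ae_rel M = {(X, Y). X \<in> borel_measurable M \<and> Y \<in> borel_measurable M \<and> (AE \<omega> in M. X \<omega> = Y \<omega>)}"

definition ae_class :: "'a measure \<Rightarrow> ('a \<Rightarrow> real) \<Rightarrow> ('a \<Rightarrow> real) set" where
  "ae_class M X = ae_rel M `` {X}"

definition L0_space :: "'a measure \<Rightarrow> ('a \<Rightarrow> real) set set" where
  "L0_space M = borel_measurable M // ae_rel M"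

definition L1_space :: "'a measure \<Rightarrow> ('a \<Rightarrow> real) set set" where
  "L1_space M = {X. integrable M X} // ae_rel M"

text \<open>Everything below is defined on classes through an arbitrary representative; the lemmas
  at the end of this theory state that the choice is immaterial.\<close>

definition rep :: "('a \<Rightarrow> real) set \<Rightarrow> 'a \<Rightarrow> real" where
  "rep A = (SOME X. X \<in> A)"

definition class_zero :: "'a measure \<Rightarrow> ('a \<Rightarrow> real) set" where
  "class_zero M = ae_class M (\<lambda>_. 0)"

definition class_add :: "'a measure \<Rightarrow> ('a \<Rightarrow> real) set \<Rightarrow> ('a \<Rightarrow> real) set \<Rightarrow> ('a \<Rightarrow> real) set" where
  "class_add M A B = ae_class M (\<lambda>\<omega>. rep A \<omega> + rep B \<omega>)"

definition class_scale :: "'a measure \<Rightarrow> real \<Rightarrow> ('a \<Rightarrow> real) set \<Rightarrow> ('a \<Rightarrow> real) set" where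
  "class_scale M c A = ae_class M (\<lambda>\<omega>. c * rep A \<omega>)"

definition class_diff :: "'a measure \<Rightarrow> ('a \<Rightarrow> real) set \<Rightarrow> ('a \<Rightarrow> real) set \<Rightarrow> ('a \<Rightarrow> real) set" where
  "class_diff M A B = class_add M A (class_scale M (-1) B)"

definition pairing :: "'a measure \<Rightarrow> ('a \<Rightarrow> real) set \<Rightarrow> ('a \<Rightarrow> real) set \<Rightarrow> real" where
  "pairing M A B = (\<integral>\<omega>. rep A \<omega> * rep B \<omega> \<partial>M)"

definition linear_subspace :: "'a measure \<Rightarrow> ('a \<Rightarrow> real) set set \<Rightarrow> bool" where
  "linear_subspace M V \<longleftrightarrow> V \<subseteq> L0_space M \<and> class_zero M \<in> V \<and>
     (\<forall>A\<in>V. \<forall>B\<in>V. class_add M A B \<in> V) \<and> (\<forall>c. \<forall>A\<in>V. class_scale M c A \<in> V)"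

definition normed_subspace ::
    "'a measure \<Rightarrow> ('a \<Rightarrow> real) set set \<Rightarrow> (('a \<Rightarrow> real) set \<Rightarrow> ennreal) \<Rightarrow> bool" where
  "normed_subspace M V N \<longleftrightarrow> linear_subspace M V \<and>
     (\<forall>A\<in>V. N A < \<infinity>) \<and>
     (\<forall>A\<in>V. N A = 0 \<longleftrightarrow> A = class_zero M) \<and>
     (\<forall>c. \<forall>A\<in>V. N (class_scale M c A) = ennreal \<bar>c\<bar> * N A) \<and>
     (\<forall>A\<in>V. \<forall>B\<in>V. N (class_add M A B) \<le> N A + N B)"

text \<open>Functionals on \<open>V\<close> are taken to be \<^const>\<open>undefined\<close> outside \<open>V\<close>, so that equality of
  functionals is equality on \<open>V\<close>.\<close>

definition linear_functionals :: "'a measure \<Rightarrow> ('a \<Rightarrow> real) set set \<Rightarrow> (('a \<Rightarrow> real) set \<Rightarrow> real) set" where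
  "linear_functionals M V = {\<phi> \<in> extensional V.
     (\<forall>A\<in>V. \<forall>B\<in>V. \<phi> (class_add M A B) = \<phi> A + \<phi> B) \<and>
     (\<forall>c. \<forall>A\<in>V. \<phi> (class_scale M c A) = c * \<phi> A)}"

definition continuous_functional ::
    "'a measure \<Rightarrow> ('a \<Rightarrow> real) set set \<Rightarrow> (('a \<Rightarrow> real) set \<Rightarrow> ennreal) \<Rightarrow>
     (('a \<Rightarrow> real) set \<Rightarrow> real) \<Rightarrow> bool" where
  "continuous_functional M V N \<phi> \<longleftrightarrow>
     (\<forall>A\<in>V. \<forall>\<epsilon>>0. \<exists>\<delta>>0. \<forall>B\<in>V. N (class_diff M B A) < ennreal \<delta> \<longrightarrow> \<bar>\<phi> B - \<phi> A\<bar> < \<epsilon>)"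

definition dual_space ::
    "'a measure \<Rightarrow> ('a \<Rightarrow> real) set set \<Rightarrow> (('a \<Rightarrow> real) set \<Rightarrow> ennreal) \<Rightarrow>
     (('a \<Rightarrow> real) set \<Rightarrow> real) set" where
  "dual_space M V N = {\<phi> \<in> linear_functionals M V. continuous_functional M V N \<phi>}"

definition operator_norm ::
    "('a \<Rightarrow> real) set set \<Rightarrow> (('a \<Rightarrow> real) set \<Rightarrow> ennreal) \<Rightarrow>
     (('a \<Rightarrow> real) set \<Rightarrow> real) \<Rightarrow> ennreal" where
  "operator_norm V N \<phi> = (SUP A\<in>{A \<in> V. N A \<le> 1}. ennreal \<bar>\<phi> A\<bar>)"

section \<open>Spectral functions and the associated norms\<close>

text \<open>Only the values of \<open>\<sigma>\<close> on \<open>[0,1)\<close> matter.\<close>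

definition spectral_function :: "(real \<Rightarrow> real) \<Rightarrow> bool" where
  "spectral_function \<sigma> \<longleftrightarrow> mono_on {0..<1} \<sigma> \<and> (\<forall>u\<in>{0..<1}. 0 \<le> \<sigma> u) \<and>
     set_integrable lborel {0..<1} \<sigma> \<and> (LBINT u:{0..<1}. \<sigma> u) = 1"

definition quantile :: "'a measure \<Rightarrow> ('a \<Rightarrow> real) \<Rightarrow> real \<Rightarrow> real" where
  "quantile M Y u = Inf {y. u \<le> measure M {\<omega> \<in> space M. Y \<omega> \<le> y}}"

text \<open>The integrand is nonnegative, so the integral always exists in \<open>[0,\<infinity>]\<close>.\<close>

definition rv_sigma_norm :: "'a measure \<Rightarrow> (real \<Rightarrow> real) \<Rightarrow> ('a \<Rightarrow> real) \<Rightarrow> ennreal" where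
  "rv_sigma_norm M \<sigma> Y = (\<integral>\<^sup>+u\<in>{0<..<1}. ennreal (\<sigma> u * quantile M (\<lambda>\<omega>. \<bar>Y \<omega>\<bar>) u) \<partial>lborel)"

definition sigma_norm :: "'a measure \<Rightarrow> (real \<Rightarrow> real) \<Rightarrow> ('a \<Rightarrow> real) set \<Rightarrow> ennreal" where
  "sigma_norm M \<sigma> A = rv_sigma_norm M \<sigma> (rep A)"

definition L_sigma :: "'a measure \<Rightarrow> (real \<Rightarrow> real) \<Rightarrow> ('a \<Rightarrow> real) set set" where
  "L_sigma M \<sigma> = {A \<in> L0_space M. sigma_norm M \<sigma> A < \<infinity>}"

definition avar :: "'a measure \<Rightarrow> real \<Rightarrow> ('a \<Rightarrow> real) \<Rightarrow> real" where
  "avar M \<alpha> Y = 1 / (1 - \<alpha>) * (LBINT u:{\<alpha><..<1}. quantile M Y u)"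

text \<open>In the type \<^typ>\<open>ennreal\<close> the infimum of the empty set is \<open>\<infinity>\<close>.\<close>

definition rv_sigma_dual_norm :: "'a measure \<Rightarrow> (real \<Rightarrow> real) \<Rightarrow> ('a \<Rightarrow> real) \<Rightarrow> ennreal" where
  "rv_sigma_dual_norm M \<sigma> Z = Inf (ennreal ` {\<eta>. 0 \<le> \<eta> \<and>
     (\<forall>\<alpha>\<in>{0..<1}. avar M \<alpha> (\<lambda>\<omega>. \<bar>Z \<omega>\<bar>) \<le> \<eta> / (1 - \<alpha>) * (LBINT u:{\<alpha><..<1}. \<sigma> u))})"

definition sigma_dual_norm :: "'a measure \<Rightarrow> (real \<Rightarrow> real) \<Rightarrow> ('a \<Rightarrow> real) set \<Rightarrow> ennreal" where
  "sigma_dual_norm M \<sigma> A = rv_sigma_dual_norm M \<sigma> (rep A)"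

definition L_sigma_star :: "'a measure \<Rightarrow> (real \<Rightarrow> real) \<Rightarrow> ('a \<Rightarrow> real) set set" where
  "L_sigma_star M \<sigma> = {A \<in> L1_space M. sigma_dual_norm M \<sigma> A < \<infinity>}"

definition duality_map ::
    "'a measure \<Rightarrow> (real \<Rightarrow> real) \<Rightarrow> ('a \<Rightarrow> real) set \<Rightarrow> ('a \<Rightarrow> real) set \<Rightarrow> real" where
  "duality_map M \<sigma> Z = (\<lambda>Y\<in>L_sigma M \<sigma>. pairing M Y Z)"

section \<open>Independence of representatives\<close>

lemma ae_class_eq_iff:
  assumes "X \<in> borel_measurable M" "Y \<in> borel_measurable M"
  shows "ae_class M X = ae_class M Y \<longleftrightarrow> (AE \<omega> in M. X \<omega> = Y \<omega>)"
proof
  assume "ae_class M X = ae_class M Y"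
  moreover have "Y \<in> ae_class M Y" using assms by (simp add: ae_class_def ae_rel_def)
  ultimately have "Y \<in> ae_class M X" by simp
  then show "AE \<omega> in M. X \<omega> = Y \<omega>" by (simp add: ae_class_def ae_rel_def)
next
  assume e: "AE \<omega> in M. X \<omega> = Y \<omega>"
  have "(AE \<omega> in M. X \<omega> = W \<omega>) \<longleftrightarrow> (AE \<omega> in M. Y \<omega> = W \<omega>)" for W
  proof
    assume "AE \<omega> in M. X \<omega> = W \<omega>"
    with e show "AE \<omega> in M. Y \<omega> = W \<omega>" by eventually_elim simp
  next
    assume "AE \<omega> in M. Y \<omega> = W \<omega>"
    with e show "AE \<omega> in M. X \<omega> = W \<omega>" by eventually_elim simp
  qed
  then show "ae_class M X = ae_class M Y" using assms by (auto simp: ae_class_def ae_rel_def)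
qed

lemma rep_ae_class:
  assumes "X \<in> borel_measurable M"
  shows "rep (ae_class M X) \<in> borel_measurable M" "AE \<omega> in M. rep (ae_class M X) \<omega> = X \<omega>"
proof -
  have "X \<in> ae_class M X" using assms by (simp add: ae_class_def ae_rel_def)
  then have "rep (ae_class M X) \<in> ae_class M X" unfolding rep_def by (metis someI)
  then show "rep (ae_class M X) \<in> borel_measurable M" "AE \<omega> in M. rep (ae_class M X) \<omega> = X \<omega>"
    by (auto simp: ae_class_def ae_rel_def elim: AE_mp)
qed

lemma L0_space_eq: "L0_space M = ae_class M ` borel_measurable M"
  by (auto simp: L0_space_def ae_class_def quotient_def)

lemma L1_space_eq: "L1_space M = ae_class M ` {X. integrable M X}"
  by (auto simp: L1_space_def ae_class_def quotient_def)

lemma class_add_ae_class: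
  assumes [measurable]: "X \<in> borel_measurable M" "Y \<in> borel_measurable M"
  shows "class_add M (ae_class M X) (ae_class M Y) = ae_class M (\<lambda>\<omega>. X \<omega> + Y \<omega>)"
proof -
  note [measurable] = rep_ae_class(1)[OF assms(1)] rep_ae_class(1)[OF assms(2)]
  have "AE \<omega> in M. rep (ae_class M X) \<omega> + rep (ae_class M Y) \<omega> = X \<omega> + Y \<omega>"
    using rep_ae_class(2)[OF assms(1)] rep_ae_class(2)[OF assms(2)] by eventually_elim simp
  then show ?thesis unfolding class_add_def by (subst ae_class_eq_iff) auto
qed

lemma class_scale_ae_class:
  assumes [measurable]: "X \<in> borel_measurable M"
  shows "class_scale M c (ae_class M X) = ae_class M (\<lambda>\<omega>. c * X \<omega>)"
proof -
  note [measurable] = rep_ae_class(1)[OF assms]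
  have "AE \<omega> in M. c * rep (ae_class M X) \<omega> = c * X \<omega>"
    using rep_ae_class(2)[OF assms(1)] by eventually_elim simp
  then show ?thesis unfolding class_scale_def by (subst ae_class_eq_iff) auto
qed

lemma pairing_ae_class:
  assumes [measurable]: "X \<in> borel_measurable M" "Y \<in> borel_measurable M"
  shows "pairing M (ae_class M X) (ae_class M Y) = (\<integral>\<omega>. X \<omega> * Y \<omega> \<partial>M)"
proof -
  note [measurable] = rep_ae_class(1)[OF assms(1)] rep_ae_class(1)[OF assms(2)]
  have "AE \<omega> in M. rep (ae_class M X) \<omega> * rep (ae_class M Y) \<omega> = X \<omega> * Y \<omega>"
    using rep_ae_class(2)[OF assms(1)] rep_ae_class(2)[OF assms(2)] by eventually_elim simp
  then show ?thesis unfolding pairing_def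
    by (intro integral_cong_AE) auto
qed

lemma quantile_abs_cong_AE:
  assumes [measurable]: "X \<in> borel_measurable M" "Y \<in> borel_measurable M"
    and e: "AE \<omega> in M. X \<omega> = Y \<omega>"
  shows "quantile M (\<lambda>\<omega>. \<bar>X \<omega>\<bar>) = quantile M (\<lambda>\<omega>. \<bar>Y \<omega>\<bar>)"
proof -
  have "measure M {\<omega> \<in> space M. \<bar>X \<omega>\<bar> \<le> y} = measure M {\<omega> \<in> space M. \<bar>Y \<omega>\<bar> \<le> y}" for y
  proof (rule measure_eq_AE)
    show "AE \<omega> in M. (\<omega> \<in> {\<omega> \<in> space M. \<bar>X \<omega>\<bar> \<le> y}) = (\<omega> \<in> {\<omega> \<in> space M. \<bar>Y \<omega>\<bar> \<le> y})"
      using e by eventually_elim simp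
  qed measurable
  then show ?thesis by (simp add: quantile_def fun_eq_iff)
qed

lemma sigma_norm_ae_class:
  assumes "X \<in> borel_measurable M"
  shows "sigma_norm M \<sigma> (ae_class M X) = rv_sigma_norm M \<sigma> X"
  using quantile_abs_cong_AE[OF rep_ae_class(1)[OF assms] assms rep_ae_class(2)[OF assms]]
  by (simp add: sigma_norm_def rv_sigma_norm_def)

lemma sigma_dual_norm_ae_class:
  assumes "X \<in> borel_measurable M"
  shows "sigma_dual_norm M \<sigma> (ae_class M X) = rv_sigma_dual_norm M \<sigma> X"
  using quantile_abs_cong_AE[OF rep_ae_class(1)[OF assms] assms rep_ae_class(2)[OF assms]]
  by (simp add: sigma_dual_norm_def rv_sigma_dual_norm_def avar_def)

end

theory Submission
  imports Defs
begin

text \<open>Write \<open>H \<alpha> = \<integral>\<^bsub>\<alpha>\<^esub>\<^bsup>1\<^esup> \<sigma>(u) du\<close> for the tail of \<open>\<sigma>\<close> and \<open>K\<^sub>Z \<alpha>\<close> for the integral of the quantile function of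
  \<open>|Z|\<close> over \<open>(\<alpha>,1)\<close>. The duality can be read off from indicators of events, whose norm is
  \<open>\<parallel>1\<^sub>A\<parallel>\<^sub>\<sigma> = H (1 - P A)\<close>.

  By Fubini, \<open>\<parallel>Y\<parallel>\<^sub>\<sigma> = \<integral>\<^bsub>0\<^esub>\<^bsup>\<infinity>\<^esup> H (P (|Y| \<le> t)) dt\<close> (\<open>snorm_layer_cake\<close>): the norm of \<open>Y\<close> is the integral of the
  norms of the indicators of its level sets \<open>{|Y| > t}\<close>. Suppose that \<open>E |Z| 1\<^sub>A \<le> c H (1 - P A)\<close> for
  all events \<open>A\<close>. Integrating over the level sets of \<open>Y\<close> gives \<open>E |Y Z| \<le> c \<parallel>Y\<parallel>\<^sub>\<sigma>\<close>
  (\<open>Holder_tail_bounded\<close>). Conversely, testing \<open>Z\<close> against \<open>sgn Z 1\<^sub>A\<close> recovers the condition from an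
  operator bound \<open>c\<close> (\<open>tail_bounded_sign_testI\<close>). So the operator norm is the least such \<open>c\<close>.

  This least \<open>c\<close> is the dual norm, that is, the condition on events is equivalent to \<open>K\<^sub>Z \<le> c H\<close> on
  \<open>[0,1)\<close> (\<open>tail_bounded_iff_avar\<close>). One direction is \<open>E |Z| 1\<^sub>A \<le> K\<^sub>Z (1 - P A)\<close>. For the other,
  \<open>K\<^sub>Z\<close> is affine between \<open>P (|Z| < s)\<close> and \<open>P (|Z| \<le> s)\<close>, its values at these two points are the masses
  of \<open>|Z|\<close> on \<open>{|Z| \<ge> s}\<close> and \<open>{|Z| > s}\<close>, and \<open>H\<close> is concave because \<open>\<sigma>\<close> is nondecreasing.

  The triangle inequality for \<open>\<parallel>\<cdot>\<parallel>\<^sub>\<sigma>\<close> comes from slicing \<open>\<sigma>\<close> instead of \<open>Y\<close>: the norm is a mixture of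
  the \<open>K\<^sub>Y \<alpha>\<close>, and \<open>K\<^sub>Y \<alpha> = min\<^bsub>s \<ge> 0\<^esub> (s (1 - \<alpha>) + E (|Y| - s)\<^sup>+)\<close> is subadditive in \<open>Y\<close>.

  For surjectivity, a bounded functional \<open>\<phi>\<close> gives the set function \<open>\<nu> A = \<phi> 1\<^sub>A\<close> with
  \<open>|\<nu> A| \<le> c H (1 - P A)\<close>, which tends to 0 with \<open>P A\<close>. Hence the positive and negative parts of \<open>\<nu>\<close> are
  measures with Radon--Nikodym densities, whose difference \<open>Z\<close> represents \<open>\<phi>\<close> on simple functions
  and satisfies the dual bound. Simple functions are dense in \<open>L\<^sub>\<sigma>\<close> by dominated convergence
  (\<open>snorm_dominated_convergence\<close>), so \<open>Z\<close> represents \<open>\<phi>\<close> everywhere.\<close>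

section \<open>Layer-cake integration\<close>

text \<open>Fubini applied to \<open>(f - s)\<^sup>+ = \<integral>\<^bsub>t \<ge> s\<^esub> 1\<^bsub>t < f\<^esub> dt\<close>. It is applied below to quantile functions and to
  \<open>\<sigma>\<close> on the unit interval as well as to random variables; the lower limit \<open>s\<close> yields the
  excess over a threshold.\<close>
lemma layer_cake:
  fixes f :: "'a \<Rightarrow> real" and w :: "'a \<Rightarrow> ennreal"
  assumes "sigma_finite_measure N"
    and [measurable]: "f \<in> borel_measurable N" "w \<in> borel_measurable N"
  shows "(\<integral>\<^sup>+x. w x * ennreal (f x - s) \<partial>N) =
    (\<integral>\<^sup>+t\<in>{s..}. (\<integral>\<^sup>+x. w x * indicator {x. t < f x} x \<partial>N) \<partial>lborel)"
proof -
  interpret N: sigma_finite_measure N by fact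
  interpret pair_sigma_finite N lborel ..
  have "ennreal (f x - s) = (\<integral>\<^sup>+t. indicator {s..<f x} t \<partial>lborel)" for x
    by (cases "s \<le> f x") (auto simp: ennreal_neg)
  then have "(\<integral>\<^sup>+x. w x * ennreal (f x - s) \<partial>N) =
      (\<integral>\<^sup>+x. (\<integral>\<^sup>+t. w x * indicator {s..<f x} t \<partial>lborel) \<partial>N)"
    by (simp add: nn_integral_cmult)
  also have "\<dots> = (\<integral>\<^sup>+x. (\<integral>\<^sup>+t. w x * (if s \<le> t \<and> t < f x then 1 else 0) \<partial>lborel) \<partial>N)"
    by (intro nn_integral_cong) (auto simp: indicator_def)
  also have "\<dots> = (\<integral>\<^sup>+t. (\<integral>\<^sup>+x. w x * (if s \<le> t \<and> t < f x then 1 else 0) \<partial>N) \<partial>lborel)"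
    by (rule Fubini'[symmetric]) measurable
  also have "\<dots> = (\<integral>\<^sup>+t\<in>{s..}. (\<integral>\<^sup>+x. w x * indicator {x. t < f x} x \<partial>N) \<partial>lborel)"
    by (intro nn_integral_cong) (auto simp: indicator_def intro!: nn_integral_cong)
  finally show ?thesis .
qed

section \<open>Tails of a spectral function\<close>

definition tail_mass :: "(real \<Rightarrow> real) \<Rightarrow> real \<Rightarrow> real" where
  "tail_mass \<sigma> \<alpha> = (LBINT u:{\<alpha><..<1}. \<sigma> u)"

locale spectral =
  fixes \<sigma> :: "real \<Rightarrow> real"
  assumes spectral: "spectral_function \<sigma>"
begin

text \<open>\<open>\<sigma>\<close> is arbitrary outside \<open>[0,1)\<close>; cutting it off makes it a measurable, nonnegative density on
  the whole line.\<close>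
definition dens :: "real \<Rightarrow> real" where
  "dens u = indicator {0<..<1} u * \<sigma> u"

abbreviation H :: "real \<Rightarrow> real" where "H \<equiv> tail_mass \<sigma>"

lemma sigma_mono: "0 \<le> x \<Longrightarrow> x \<le> y \<Longrightarrow> y < 1 \<Longrightarrow> \<sigma> x \<le> \<sigma> y"
  using spectral by (auto simp: spectral_function_def mono_on_def)

lemma sigma_nonneg: "0 \<le> x \<Longrightarrow> x < 1 \<Longrightarrow> 0 \<le> \<sigma> x"
  using spectral by (auto simp: spectral_function_def)

lemma dens_nonneg: "0 \<le> dens u"
  using sigma_nonneg by (auto simp: dens_def indicator_def)

lemma dens_eq_indicator: "dens u = indicator {0<..<1} u * (indicator {0..<1} u *\<^sub>R \<sigma> u)"
  by (auto simp: dens_def indicator_def)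

lemma borel_measurable_dens[measurable]: "dens \<in> borel_measurable borel"
proof -
  have [measurable]: "(\<lambda>u. indicator {0..<1} u *\<^sub>R \<sigma> u) \<in> borel_measurable borel"
    using spectral unfolding spectral_function_def set_integrable_def
    by (auto dest!: borel_measurable_integrable)
  show ?thesis unfolding dens_eq_indicator[abs_def] by measurable
qed

lemma AE_dens: "AE u in lborel. dens u = indicator {0..<1} u *\<^sub>R \<sigma> u"
  using AE_lborel_singleton[of 0] by eventually_elim (auto simp: dens_def indicator_def)

lemma integrable_dens: "integrable lborel dens" and integral_dens: "integral\<^sup>L lborel dens = 1"
proof -
  have m: "(\<lambda>u. indicator {0..<1} u *\<^sub>R \<sigma> u) \<in> borel_measurable lborel"
    and i: "integrable lborel (\<lambda>u. indicator {0..<1} u *\<^sub>R \<sigma> u)"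
    using spectral unfolding spectral_function_def set_integrable_def
    by (auto dest!: borel_measurable_integrable)
  show "integrable lborel dens"
    using integrable_cong_AE[OF _ m AE_dens] i by simp
  show "integral\<^sup>L lborel dens = 1"
    using integral_cong_AE[OF _ m AE_dens] spectral
    by (simp add: spectral_function_def set_lebesgue_integral_def)
qed

lemma tail_mass_eq: "0 \<le> a \<Longrightarrow> H a = (\<integral>u. indicator {a<..} u * dens u \<partial>lborel)"
  unfolding tail_mass_def set_lebesgue_integral_def
  by (intro Bochner_Integration.integral_cong) (auto simp: dens_def indicator_def)

lemma integrable_tail: "integrable lborel (\<lambda>u. indicator {a<..} u * dens u)"
  using integrable_mult_indicator[of "{a<..}" lborel dens] integrable_dens by simp

lemma nn_integral_tail:
  assumes "0 \<le> a" shows "(\<integral>\<^sup>+u\<in>{a<..<1}. ennreal (\<sigma> u) \<partial>lborel) = ennreal (H a)"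
proof -
  have "(\<integral>\<^sup>+u\<in>{a<..<1}. ennreal (\<sigma> u) \<partial>lborel) = (\<integral>\<^sup>+u. ennreal (indicator {a<..} u * dens u) \<partial>lborel)"
    using assms by (intro nn_integral_cong) (auto simp: dens_def indicator_def)
  also have "\<dots> = ennreal (H a)"
    unfolding tail_mass_eq[OF assms]
    by (intro nn_integral_eq_integral integrable_tail) (auto simp: dens_nonneg)
  finally show ?thesis .
qed

lemma tail_mass_nonneg: "0 \<le> a \<Longrightarrow> 0 \<le> H a"
  by (simp add: tail_mass_eq dens_nonneg integral_nonneg)

lemma tail_mass_1[simp]: "H 1 = 0"
  by (simp add: tail_mass_def set_lebesgue_integral_def)

lemma tail_mass_0[simp]: "H 0 = 1"
proof -
  have *: "indicator {0<..} u * dens u = dens u" for u by (auto simp: dens_def indicator_def)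
  show ?thesis unfolding tail_mass_eq[OF order_refl] * by (rule integral_dens)
qed

text \<open>Since \<open>\<sigma>\<close> is nondecreasing, \<open>H\<close> is concave with supergradient \<open>-\<sigma> x\<close> at \<open>x\<close>. In this form
  concavity needs no division and covers both sides of \<open>x\<close>. The reason is that
  \<open>(1\<^bsub>u > x\<^esub> - 1\<^bsub>u > y\<^esub>) (\<sigma> u - \<sigma> x) \<ge> 0\<close> for every \<open>u\<close>.\<close>
lemma tail_mass_supergradient:
  assumes "0 \<le> x" "x < 1" "0 \<le> y" "y \<le> 1"
  shows "H y \<le> H x - (y - x) * \<sigma> x"
proof -
  let ?e = "\<lambda>a u. indicator {a<..} u * dens u - \<sigma> x * indicator {a<..<1} u"
  have int: "integrable lborel (?e a)" for a
    by (intro Bochner_Integration.integrable_diff integrable_tail integrable_mult_right)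
      (cases "a \<le> 1"; simp)
  have eq: "(\<integral>u. ?e a u \<partial>lborel) = H a - \<sigma> x * (1 - a)" if "0 \<le> a" "a \<le> 1" for a
    using that
    by (subst Bochner_Integration.integral_diff) (auto simp: integrable_tail tail_mass_eq)
  have "?e y u \<le> ?e x u" for u
    using assms sigma_mono[of x u] sigma_mono[of u x] by (auto simp: indicator_def dens_def)
  then have "(\<integral>u. ?e y u \<partial>lborel) \<le> (\<integral>u. ?e x u \<partial>lborel)"
    by (intro integral_mono int)
  then have "H y - \<sigma> x * (1 - y) \<le> H x - \<sigma> x * (1 - x)"
    unfolding eq[OF assms(3,4)] eq[OF assms(1) less_imp_le[OF assms(2)]] .
  then show ?thesis by (simp add: algebra_simps)
qed

lemma tail_mass_antimono:
  assumes "0 \<le> x" "x \<le> y" "y \<le> 1" shows "H y \<le> H x"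
proof (cases "x < 1")
  case True
  have "0 \<le> (y - x) * \<sigma> x" using assms True sigma_nonneg by simp
  then show ?thesis using tail_mass_supergradient[of x y] assms True by simp
next
  case False
  then have "x = y" using assms by simp
  then show ?thesis by simp
qed

text \<open>Concavity between the end values \<open>H 0 = 1\<close> and \<open>H 1 = 0\<close>. This is what embeds \<open>L\<^sub>\<sigma>\<close>
  into \<open>L\<^sup>1\<close> with norm one.\<close>
lemma tail_mass_ge:
  assumes "0 \<le> x" "x \<le> 1" shows "1 - x \<le> H x"
proof (cases "x < 1")
  case True
  have a: "1 \<le> H x + x * \<sigma> x" and b: "(1 - x) * \<sigma> x \<le> H x"
    using tail_mass_supergradient[of x 0] tail_mass_supergradient[of x 1] assms True by auto
  have "(1 - x) * 1 \<le> (1 - x) * (H x + x * \<sigma> x)" using a assms by (intro mult_left_mono) auto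
  moreover have "x * ((1 - x) * \<sigma> x) \<le> x * H x" using b assms by (intro mult_left_mono) auto
  ultimately show ?thesis by (simp add: algebra_simps)
qed (use assms in simp)

text \<open>Continuity of \<open>H\<close> at the right end point makes indicators of small sets small in
  \<open>L\<^sub>\<sigma>\<close>, hence set functions dominated by \<open>H (1 - P A)\<close> countably additive.\<close>
lemma tail_mass_tendsto_0:
  assumes lim: "X \<longlonglongrightarrow> 1" and nn: "\<And>n::nat. 0 \<le> X n"
  shows "(\<lambda>n. H (X n)) \<longlonglongrightarrow> 0"
proof -
  have "(\<lambda>n. \<integral>u. indicator {X n<..} u * dens u \<partial>lborel) \<longlonglongrightarrow> (\<integral>u. 0 \<partial>(lborel::real measure))"
  proof (rule integral_dominated_convergence[where w = dens])
    show "AE u in lborel. (\<lambda>n. indicator {X n<..} u * dens u) \<longlonglongrightarrow> 0"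
    proof (intro AE_I2)
      fix u :: real
      show "(\<lambda>n. indicator {X n<..} u * dens u) \<longlonglongrightarrow> 0"
      proof (cases "u < 1")
        case True
        have "eventually (\<lambda>n. u < X n) sequentially" using lim True by (rule order_tendstoD)
        then show ?thesis by (intro tendsto_eventually) (auto elim!: eventually_mono)
      qed (simp add: dens_def)
    qed
  qed (auto simp: integrable_dens dens_nonneg indicator_def)
  then show ?thesis by (simp add: tail_mass_eq nn)
qed

end

section \<open>Quantiles and tail expectations\<close>

context prob_space
begin

definition abs_cdf :: "('a \<Rightarrow> real) \<Rightarrow> real \<Rightarrow> real" where
  "abs_cdf Y t = prob {\<omega> \<in> space M. \<bar>Y \<omega>\<bar> \<le> t}"

definition abs_quantile :: "('a \<Rightarrow> real) \<Rightarrow> real \<Rightarrow> real" where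
  "abs_quantile Y u = quantile M (\<lambda>\<omega>. \<bar>Y \<omega>\<bar>) u"

lemma abs_cdf_bounds[simp]: "0 \<le> abs_cdf Y t" "abs_cdf Y t \<le> 1"
  by (auto simp: abs_cdf_def)

lemma abs_cdf_neg: "t < 0 \<Longrightarrow> abs_cdf Y t = 0"
  by (auto simp: abs_cdf_def intro!: arg_cong[where f=prob, of _ "{}", simplified])

lemma abs_cdf_mono:
  assumes [measurable]: "Y \<in> borel_measurable M" and "s \<le> t"
  shows "abs_cdf Y s \<le> abs_cdf Y t"
  unfolding abs_cdf_def using assms(2) by (intro finite_measure_mono) auto

lemma borel_measurable_abs_cdf[measurable]:
  assumes "Y \<in> borel_measurable M" shows "abs_cdf Y \<in> borel_measurable borel"
  by (intro borel_measurable_mono monoI abs_cdf_mono assms)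

lemma prob_abs_gt:
  assumes [measurable]: "Y \<in> borel_measurable M"
  shows "prob {\<omega> \<in> space M. t < \<bar>Y \<omega>\<bar>} = 1 - abs_cdf Y t"
proof -
  have "{\<omega> \<in> space M. t < \<bar>Y \<omega>\<bar>} = space M - {\<omega> \<in> space M. \<bar>Y \<omega>\<bar> \<le> t}" by auto
  then show ?thesis unfolding abs_cdf_def by (simp add: prob_compl)
qed

lemma
  assumes [measurable]: "Y \<in> borel_measurable M"
  shows abs_quantile_le_iff:
      "0 < u \<Longrightarrow> u < 1 \<Longrightarrow> abs_quantile Y u \<le> t \<longleftrightarrow> u \<le> abs_cdf Y t"
    and borel_measurable_abs_quantile:
      "(\<lambda>u. indicator {0<..<1} u * abs_quantile Y u) \<in> borel_measurable borel"
proof -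
  interpret D: real_distribution "distr M borel (\<lambda>\<omega>. \<bar>Y \<omega>\<bar>)" by simp
  interpret D: cdf_distribution "distr M borel (\<lambda>\<omega>. \<bar>Y \<omega>\<bar>)" ..
  have C: "D.C t = abs_cdf Y t" for t
    by (auto simp: cdf_def abs_cdf_def measure_distr intro!: arg_cong[where f=prob])
  have I: "Inf {x. u \<le> abs_cdf Y x} = abs_quantile Y u" for u
    by (simp add: abs_cdf_def abs_quantile_def quantile_def)
  show "0 < u \<Longrightarrow> u < 1 \<Longrightarrow> abs_quantile Y u \<le> t \<longleftrightarrow> u \<le> abs_cdf Y t"
    using D.pseudoinverse[of u t] unfolding C I by simp
  show "(\<lambda>u. indicator {0<..<1} u * abs_quantile Y u) \<in> borel_measurable borel"
    using D.measurable_CI unfolding C I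
    by (subst (asm) borel_measurable_restrict_space_iff) (auto simp: mult.commute)
qed

lemma abs_quantile_nonneg:
  assumes "Y \<in> borel_measurable M" "0 < u" "u < 1" shows "0 \<le> abs_quantile Y u"
proof (rule ccontr)
  assume "\<not> 0 \<le> abs_quantile Y u"
  then have "u \<le> abs_cdf Y (abs_quantile Y u)" "abs_cdf Y (abs_quantile Y u) = 0"
    using abs_quantile_le_iff[OF assms, of "abs_quantile Y u"] by (auto simp: abs_cdf_neg)
  with assms show False by simp
qed

lemma abs_quantile_scale:
  assumes [measurable]: "Y \<in> borel_measurable M" and u: "0 < u" "u < 1" and c: "c \<noteq> 0"
  shows "abs_quantile (\<lambda>\<omega>. c * Y \<omega>) u = \<bar>c\<bar> * abs_quantile Y u"
proof -
  have "abs_cdf (\<lambda>\<omega>. c * Y \<omega>) t = abs_cdf Y (t / \<bar>c\<bar>)" for t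
    using c unfolding abs_cdf_def
    by (intro arg_cong[where f=prob]) (auto simp: abs_mult field_simps)
  then have "abs_quantile (\<lambda>\<omega>. c * Y \<omega>) u \<le> t \<longleftrightarrow> \<bar>c\<bar> * abs_quantile Y u \<le> t" for t
    using abs_quantile_le_iff[of "\<lambda>\<omega>. c * Y \<omega>" u t] abs_quantile_le_iff[of Y u "t / \<bar>c\<bar>"] u c
    by (simp add: field_simps)
  from this[of "abs_quantile (\<lambda>\<omega>. c * Y \<omega>) u"] this[of "\<bar>c\<bar> * abs_quantile Y u"]
  show ?thesis by (simp add: antisym)
qed

text \<open>A weighted quantile integral becomes an integral over levels \<open>t\<close>, because the quantile exceeds
  \<open>t\<close> exactly on the upper interval that starts at the distribution function of \<open>|Y|\<close> at \<open>t\<close>. This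
  removes quantiles from all later estimates.\<close>
lemma nn_integral_abs_quantile:
  assumes [measurable]: "Y \<in> borel_measurable M" "w \<in> borel_measurable borel"
  shows "(\<integral>\<^sup>+u\<in>{0<..<1}. w u * ennreal (abs_quantile Y u) \<partial>lborel) =
    (\<integral>\<^sup>+t\<in>{0..}. (\<integral>\<^sup>+u\<in>{abs_cdf Y t<..<1}. w u \<partial>lborel) \<partial>lborel)"
proof -
  note [measurable] = borel_measurable_abs_quantile[OF assms(1)]
  let ?q = "\<lambda>u. indicator {0<..<1} u * abs_quantile Y u"
  have "(\<integral>\<^sup>+u\<in>{0<..<1}. w u * ennreal (abs_quantile Y u) \<partial>lborel) =
      (\<integral>\<^sup>+u. w u * indicator {0<..<1} u * ennreal (?q u - 0) \<partial>lborel)"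
    by (intro nn_integral_cong) (auto simp: indicator_def)
  also have "\<dots> = (\<integral>\<^sup>+t\<in>{0..}. (\<integral>\<^sup>+u. w u * indicator {0<..<1} u * indicator {u. t < ?q u} u \<partial>lborel) \<partial>lborel)"
    by (rule layer_cake) (auto intro: lborel.sigma_finite_measure_axioms)
  also have "\<dots> = (\<integral>\<^sup>+t\<in>{0..}. (\<integral>\<^sup>+u\<in>{abs_cdf Y t<..<1}. w u \<partial>lborel) \<partial>lborel)"
  proof -
    have "t < ?q u \<longleftrightarrow> abs_cdf Y t < u" if "0 < u" "u < 1" for t u
      using abs_quantile_le_iff[OF assms(1) that, of t] that by (auto simp: not_le[symmetric])
    moreover have "0 < u" if "abs_cdf Y t < u" for t u
      using that abs_cdf_bounds(1)[of Y t] by linarith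
    ultimately have "w u * indicator {0<..<1} u * indicator {u. t < ?q u} u =
        w u * indicator {abs_cdf Y t<..<1} u" for t u
      by (cases "0 < u \<and> u < 1") (auto simp: indicator_def)
    then show ?thesis by simp
  qed
  finally show ?thesis .
qed

text \<open>The unnormalised Average Value-at-Risk of \<open>|Y|\<close>, with value in \<open>[0,\<infinity>]\<close> since \<open>Y\<close> need not be
  integrable.\<close>
definition tail_expectation :: "('a \<Rightarrow> real) \<Rightarrow> real \<Rightarrow> ennreal" where
  "tail_expectation Y \<alpha> = (\<integral>\<^sup>+u\<in>{\<alpha><..<1}. ennreal (abs_quantile Y u) \<partial>lborel)"

lemma tail_expectation_layer_cake:
  assumes Y[measurable]: "Y \<in> borel_measurable M" and a: "0 \<le> a" "a \<le> 1"
  shows "tail_expectation Y a = (\<integral>\<^sup>+t\<in>{0..}. ennreal (min (1 - a) (1 - abs_cdf Y t)) \<partial>lborel)"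
proof -
  have "tail_expectation Y a = (\<integral>\<^sup>+u\<in>{0<..<1}. indicator {a<..<1} u * ennreal (abs_quantile Y u) \<partial>lborel)"
    unfolding tail_expectation_def using a by (intro nn_integral_cong) (auto simp: indicator_def)
  also have "\<dots> = (\<integral>\<^sup>+t\<in>{0..}. (\<integral>\<^sup>+u\<in>{abs_cdf Y t<..<1}. indicator {a<..<1} u \<partial>lborel) \<partial>lborel)"
    by (rule nn_integral_abs_quantile) auto
  also have "\<dots> = (\<integral>\<^sup>+t\<in>{0..}. ennreal (min (1 - a) (1 - abs_cdf Y t)) \<partial>lborel)"
  proof (intro nn_integral_cong arg_cong2[where f="(*)"] refl)
    fix t :: real
    have "(\<integral>\<^sup>+u\<in>{abs_cdf Y t<..<1}. indicator {a<..<1} u \<partial>lborel) =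
        (\<integral>\<^sup>+u. indicator {max a (abs_cdf Y t)<..<1} u \<partial>(lborel::real measure))"
      by (intro nn_integral_cong) (auto simp: indicator_def)
    also have "\<dots> = ennreal (1 - max a (abs_cdf Y t))" using a by simp
    also have "1 - max a (abs_cdf Y t) = min (1 - a) (1 - abs_cdf Y t)" by auto
    finally show "(\<integral>\<^sup>+u\<in>{abs_cdf Y t<..<1}. indicator {a<..<1} u \<partial>lborel) =
      ennreal (min (1 - a) (1 - abs_cdf Y t))" .
  qed
  finally show ?thesis .
qed

lemma nn_integral_abs_excess:
  assumes Y[measurable]: "Y \<in> borel_measurable M"
  shows "(\<integral>\<^sup>+\<omega>. ennreal (\<bar>Y \<omega>\<bar> - s) \<partial>M) = (\<integral>\<^sup>+t\<in>{s..}. ennreal (1 - abs_cdf Y t) \<partial>lborel)"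
proof -
  have "(\<integral>\<^sup>+\<omega>. indicator {\<omega>. t < \<bar>Y \<omega>\<bar>} \<omega> \<partial>M) = ennreal (1 - abs_cdf Y t)" for t
  proof -
    have "(\<integral>\<^sup>+\<omega>. indicator {\<omega>. t < \<bar>Y \<omega>\<bar>} \<omega> \<partial>M) = (\<integral>\<^sup>+\<omega>. indicator {\<omega>\<in>space M. t < \<bar>Y \<omega>\<bar>} \<omega> \<partial>M)"
      by (intro nn_integral_cong) (auto simp: indicator_def)
    also have "\<dots> = ennreal (1 - abs_cdf Y t)"
      by (simp add: emeasure_eq_measure prob_abs_gt)
    finally show ?thesis .
  qed
  then show ?thesis
    using layer_cake[of M "\<lambda>\<omega>. \<bar>Y \<omega>\<bar>" "\<lambda>_. 1" s] by (simp add: sigma_finite_measure_axioms)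
qed

text \<open>Among events of given probability, the upper level sets of \<open>|Y|\<close> carry most of its mass: level by
  level, \<open>P (A \<inter> {|Y| > t}) \<le> min (P A) (P (|Y| > t))\<close>.\<close>
lemma nn_integral_indicator_le_tail_expectation:
  assumes Y[measurable]: "Y \<in> borel_measurable M" and A[measurable]: "A \<in> events"
  shows "(\<integral>\<^sup>+\<omega>\<in>A. ennreal \<bar>Y \<omega>\<bar> \<partial>M) \<le> tail_expectation Y (1 - prob A)"
proof -
  have "(\<integral>\<^sup>+\<omega>\<in>A. ennreal \<bar>Y \<omega>\<bar> \<partial>M) = (\<integral>\<^sup>+\<omega>. indicator A \<omega> * ennreal (\<bar>Y \<omega>\<bar> - 0) \<partial>M)"
    by (simp add: mult.commute)
  also have "\<dots> = (\<integral>\<^sup>+t\<in>{0..}. (\<integral>\<^sup>+\<omega>. indicator A \<omega> * indicator {\<omega>. t < \<bar>Y \<omega>\<bar>} \<omega> \<partial>M) \<partial>lborel)"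
    by (rule layer_cake) (auto intro: sigma_finite_measure_axioms)
  also have "\<dots> \<le> (\<integral>\<^sup>+t\<in>{0..}. ennreal (min (1 - (1 - prob A)) (1 - abs_cdf Y t)) \<partial>lborel)"
  proof (intro nn_integral_mono mult_right_mono)
    fix t
    let ?B = "{\<omega>\<in>space M. t < \<bar>Y \<omega>\<bar>}"
    have "(\<integral>\<^sup>+\<omega>. indicator A \<omega> * indicator {\<omega>. t < \<bar>Y \<omega>\<bar>} \<omega> \<partial>M) = (\<integral>\<^sup>+\<omega>. indicator (A \<inter> ?B) \<omega> \<partial>M)"
      by (intro nn_integral_cong) (auto simp: indicator_def)
    also have "\<dots> = ennreal (prob (A \<inter> ?B))" by (simp add: emeasure_eq_measure)
    also have "prob (A \<inter> ?B) \<le> min (1 - (1 - prob A)) (1 - abs_cdf Y t)"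
      unfolding prob_abs_gt[OF Y, symmetric] by (auto intro!: finite_measure_mono)
    finally show "(\<integral>\<^sup>+\<omega>. indicator A \<omega> * indicator {\<omega>. t < \<bar>Y \<omega>\<bar>} \<omega> \<partial>M) \<le> ennreal (min (1 - (1 - prob A)) (1 - abs_cdf Y t))"
      by (auto intro: ennreal_leI)
  qed simp
  also have "\<dots> = tail_expectation Y (1 - prob A)"
    by (rule tail_expectation_layer_cake[symmetric]) auto
  finally show ?thesis .
qed

text \<open>Half of the Rockafellar--Uryasev formula: bound the layer \<open>min (1 - a) (P (|Y| > t))\<close> by its first
  entry below \<open>s\<close> and by its second entry above \<open>s\<close>.\<close>
lemma tail_expectation_le:
  assumes Y[measurable]: "Y \<in> borel_measurable M" and a: "0 \<le> a" "a \<le> 1" and s: "0 \<le> s"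
  shows "tail_expectation Y a \<le> ennreal (s * (1 - a)) + (\<integral>\<^sup>+\<omega>. ennreal (\<bar>Y \<omega>\<bar> - s) \<partial>M)"
proof -
  have "tail_expectation Y a \<le> (\<integral>\<^sup>+t. ennreal (1 - a) * indicator {0..<s} t + ennreal (1 - abs_cdf Y t) * indicator {s..} t \<partial>lborel)"
    unfolding tail_expectation_layer_cake[OF Y a]
    using s by (intro nn_integral_mono) (auto simp: indicator_def intro!: ennreal_leI)
  also have "\<dots> = ennreal (s * (1 - a)) + (\<integral>\<^sup>+\<omega>. ennreal (\<bar>Y \<omega>\<bar> - s) \<partial>M)"
    using s a by (subst nn_integral_add)
      (auto simp: nn_integral_abs_excess nn_integral_cmult_indicator ennreal_mult' mult.commute)
  finally show ?thesis .
qed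

text \<open>The other half: at the \<open>a\<close>-quantile \<open>s\<close> no loss occurs. The two bounds on \<open>a\<close> place it in the
  plateau of the quantile function at height \<open>s\<close>, on which the tail expectation is affine in \<open>a\<close>.\<close>
lemma tail_expectation_attained:
  assumes Y[measurable]: "Y \<in> borel_measurable M" and a: "0 \<le> a" "a < 1"
  obtains s where "0 \<le> s" "prob {\<omega>\<in>space M. \<bar>Y \<omega>\<bar> < s} \<le> a" "a \<le> abs_cdf Y s"
    "tail_expectation Y a = ennreal (s * (1 - a)) + (\<integral>\<^sup>+\<omega>. ennreal (\<bar>Y \<omega>\<bar> - s) \<partial>M)"
proof -
  have "\<exists>s\<ge>0. (\<forall>t. 0 \<le> t \<longrightarrow> t < s \<longrightarrow> abs_cdf Y t \<le> a) \<and> a \<le> abs_cdf Y s"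
  proof (cases "a = 0")
    case True then show ?thesis by (intro exI[of _ 0]) auto
  next
    case False
    with a have a': "0 < a" by simp
    then show ?thesis
      using abs_quantile_nonneg[OF Y a' a(2)] abs_quantile_le_iff[OF Y a' a(2)]
      by (intro exI[of _ "abs_quantile Y a"]) (auto simp: not_le[symmetric] intro: less_imp_le)
  qed
  then obtain s where s: "0 \<le> s" "a \<le> abs_cdf Y s"
    and below: "\<And>t. 0 \<le> t \<Longrightarrow> t < s \<Longrightarrow> abs_cdf Y t \<le> a" by auto
  have "tail_expectation Y a = (\<integral>\<^sup>+t. ennreal (1 - a) * indicator {0..<s} t + ennreal (1 - abs_cdf Y t) * indicator {s..} t \<partial>lborel)"
    unfolding tail_expectation_layer_cake[OF Y a(1) less_imp_le[OF a(2)]]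
  proof (intro nn_integral_cong)
    fix t
    have "a \<le> abs_cdf Y t" if "s \<le> t" using s(2) abs_cdf_mono[OF Y that] by simp
    then show "ennreal (min (1 - a) (1 - abs_cdf Y t)) * indicator {0..} t =
        ennreal (1 - a) * indicator {0..<s} t + ennreal (1 - abs_cdf Y t) * indicator {s..} t"
      using below[of t] s(1) by (cases "s \<le> t") (auto simp: indicator_def min_def)
  qed
  also have "\<dots> = ennreal (s * (1 - a)) + (\<integral>\<^sup>+\<omega>. ennreal (\<bar>Y \<omega>\<bar> - s) \<partial>M)"
    using s a by (subst nn_integral_add)
      (auto simp: nn_integral_abs_excess nn_integral_cmult_indicator ennreal_mult' mult.commute)
  finally have eq: "tail_expectation Y a = \<dots>" .
  (* P (|Y| < s) is the left limit at s of the distribution function, which is at most a below s *)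
  have "prob {\<omega>\<in>space M. \<bar>Y \<omega>\<bar> < s} \<le> a"
  proof (rule LIMSEQ_le_const2)
    let ?A = "\<lambda>n::nat. {\<omega>\<in>space M. \<bar>Y \<omega>\<bar> \<le> s - 1 / Suc n}"
    have "(\<lambda>n. prob (?A n)) \<longlonglongrightarrow> prob (\<Union>n. ?A n)"
      by (intro finite_Lim_measure_incseq)
        (auto intro!: incseq_SucI elim!: order_trans simp: frac_le)
    also have "(\<Union>n. ?A n) = {\<omega>\<in>space M. \<bar>Y \<omega>\<bar> < s}"
    proof (safe)
      fix \<omega> n assume "\<bar>Y \<omega>\<bar> \<le> s - 1 / real (Suc n)"
      moreover have "0 < 1 / real (Suc n)" by simp
      ultimately show "\<bar>Y \<omega>\<bar> < s" by linarith
    next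
      fix \<omega> assume "\<omega> \<in> space M" "\<bar>Y \<omega>\<bar> < s"
      moreover obtain n where "1 / real (Suc n) < s - \<bar>Y \<omega>\<bar>"
        using \<open>\<bar>Y \<omega>\<bar> < s\<close> reals_Archimedean[of "s - \<bar>Y \<omega>\<bar>"] by (auto simp: inverse_eq_divide)
      ultimately show "\<omega> \<in> (\<Union>n. ?A n)" by (auto intro!: exI[of _ n])
    qed
    finally show "(\<lambda>n. prob (?A n)) \<longlonglongrightarrow> prob {\<omega>\<in>space M. \<bar>Y \<omega>\<bar> < s}" .
    have "prob (?A n) \<le> a" for n
    proof (cases "0 \<le> s - 1 / Suc n")
      case True
      have "s - 1 / Suc n < s" by simp
      then show ?thesis using below[OF True] by (simp add: abs_cdf_def)
    next
      case False
      then show ?thesis using abs_cdf_neg[of "s - 1 / Suc n" Y] a by (simp add: abs_cdf_def)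
    qed
    then show "\<exists>N. \<forall>n\<ge>N. prob (?A n) \<le> a" by blast
  qed
  with s eq show ?thesis by (intro that)
qed

text \<open>A minimum over \<open>s\<close> of expressions that are jointly subadditive in \<open>(s, Y)\<close>: add the optimal
  thresholds of the two summands.\<close>
lemma tail_expectation_add:
  assumes [measurable]: "X \<in> borel_measurable M" "Y \<in> borel_measurable M" and a: "0 \<le> a" "a \<le> 1"
  shows "tail_expectation (\<lambda>\<omega>. X \<omega> + Y \<omega>) a \<le> tail_expectation X a + tail_expectation Y a"
proof (cases "a < 1")
  case True
  obtain s where s: "0 \<le> s" "tail_expectation X a = ennreal (s * (1 - a)) + (\<integral>\<^sup>+\<omega>. ennreal (\<bar>X \<omega>\<bar> - s) \<partial>M)"
    using tail_expectation_attained[OF assms(1) a(1) True] by metis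
  obtain t where t: "0 \<le> t" "tail_expectation Y a = ennreal (t * (1 - a)) + (\<integral>\<^sup>+\<omega>. ennreal (\<bar>Y \<omega>\<bar> - t) \<partial>M)"
    using tail_expectation_attained[OF assms(2) a(1) True] by metis
  have "(\<integral>\<^sup>+\<omega>. ennreal (\<bar>X \<omega> + Y \<omega>\<bar> - (s + t)) \<partial>M) \<le> (\<integral>\<^sup>+\<omega>. ennreal (\<bar>X \<omega>\<bar> - s) + ennreal (\<bar>Y \<omega>\<bar> - t) \<partial>M)"
  proof (intro nn_integral_mono)
    fix \<omega>
    have "ennreal (\<bar>X \<omega> + Y \<omega>\<bar> - (s + t)) \<le> ennreal (max 0 (\<bar>X \<omega>\<bar> - s) + max 0 (\<bar>Y \<omega>\<bar> - t))"
      by (intro ennreal_leI) linarith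
    also have "\<dots> = ennreal (\<bar>X \<omega>\<bar> - s) + ennreal (\<bar>Y \<omega>\<bar> - t)" by (simp add: max_def ennreal_neg)
    finally show "ennreal (\<bar>X \<omega> + Y \<omega>\<bar> - (s + t)) \<le> \<dots>" .
  qed
  also have "\<dots> = (\<integral>\<^sup>+\<omega>. ennreal (\<bar>X \<omega>\<bar> - s) \<partial>M) + (\<integral>\<^sup>+\<omega>. ennreal (\<bar>Y \<omega>\<bar> - t) \<partial>M)"
    by (rule nn_integral_add) auto
  finally have *: "(\<integral>\<^sup>+\<omega>. ennreal (\<bar>X \<omega> + Y \<omega>\<bar> - (s + t)) \<partial>M) \<le> \<dots>" .
  have "tail_expectation (\<lambda>\<omega>. X \<omega> + Y \<omega>) a \<le>
      ennreal ((s + t) * (1 - a)) + (\<integral>\<^sup>+\<omega>. ennreal (\<bar>X \<omega> + Y \<omega>\<bar> - (s + t)) \<partial>M)"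
    using a s t by (intro tail_expectation_le) auto
  also have "ennreal ((s + t) * (1 - a)) = ennreal (s * (1 - a)) + ennreal (t * (1 - a))"
    using s t a by (simp add: ring_distribs(2) del: right_diff_distrib)
  also have "\<dots> + (\<integral>\<^sup>+\<omega>. ennreal (\<bar>X \<omega> + Y \<omega>\<bar> - (s + t)) \<partial>M) \<le> ennreal (s * (1 - a)) + ennreal (t * (1 - a)) +
      ((\<integral>\<^sup>+\<omega>. ennreal (\<bar>X \<omega>\<bar> - s) \<partial>M) + (\<integral>\<^sup>+\<omega>. ennreal (\<bar>Y \<omega>\<bar> - t) \<partial>M))"
    by (intro add_mono order_refl *)
  also have "\<dots> = tail_expectation X a + tail_expectation Y a"
    by (simp add: s t ac_simps)
  finally show ?thesis .
qed (use a in \<open>simp add: tail_expectation_def\<close>)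

end

section \<open>The spectral norm\<close>

locale spectral_prob = prob_space M + spectral \<sigma> for M :: "'a measure" and \<sigma> :: "real \<Rightarrow> real"
begin

abbreviation snorm :: "('a \<Rightarrow> real) \<Rightarrow> ennreal" where "snorm \<equiv> rv_sigma_norm M \<sigma>"

lemma snorm_eq:
  "snorm X = (\<integral>\<^sup>+u\<in>{0<..<1}. ennreal (dens u) * ennreal (abs_quantile X u) \<partial>lborel)"
  unfolding rv_sigma_norm_def abs_quantile_def[symmetric]
  by (intro nn_integral_cong) (auto simp: indicator_def dens_def ennreal_mult' sigma_nonneg)

text \<open>The spectral norm is the integral, over all levels \<open>t\<close>, of the norms of the indicators of
  \<open>{|X| > t}\<close>. Monotonicity, dominated convergence and the Hoelder inequality all reduce to the
  concave function \<open>H\<close> through this formula.\<close>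
lemma snorm_layer_cake:
  assumes X[measurable]: "X \<in> borel_measurable M"
  shows "snorm X = (\<integral>\<^sup>+t\<in>{0..}. ennreal (H (abs_cdf X t)) \<partial>lborel)"
proof -
  have "snorm X = (\<integral>\<^sup>+t\<in>{0..}. (\<integral>\<^sup>+u\<in>{abs_cdf X t<..<1}. ennreal (dens u) \<partial>lborel) \<partial>lborel)"
    unfolding snorm_eq by (rule nn_integral_abs_quantile) auto
  also have "\<dots> = (\<integral>\<^sup>+t\<in>{0..}. ennreal (H (abs_cdf X t)) \<partial>lborel)"
  proof (intro nn_integral_cong arg_cong2[where f="(*)"] refl)
    fix t :: real
    have "(\<integral>\<^sup>+u\<in>{abs_cdf X t<..<1}. ennreal (dens u) \<partial>lborel) = (\<integral>\<^sup>+u\<in>{abs_cdf X t<..<1}. ennreal (\<sigma> u) \<partial>lborel)"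
      using abs_cdf_bounds(1)[of X t]
      by (intro nn_integral_cong) (auto simp: indicator_def dens_def simp del: abs_cdf_bounds)
    then show "(\<integral>\<^sup>+u\<in>{abs_cdf X t<..<1}. ennreal (dens u) \<partial>lborel) = ennreal (H (abs_cdf X t))"
      by (simp add: nn_integral_tail)
  qed
  finally show ?thesis .
qed

lemma borel_measurable_tail_mass_abs_cdf[measurable]:
  assumes X: "X \<in> borel_measurable M"
  shows "(\<lambda>t. H (abs_cdf X t)) \<in> borel_measurable borel"
proof -
  have "(\<lambda>t. - H (abs_cdf X t)) \<in> borel_measurable borel"
    by (intro borel_measurable_mono monoI) (simp add: tail_mass_antimono abs_cdf_mono X)
  then show ?thesis by simp
qed

lemma snorm_mono:
  assumes [measurable]: "X \<in> borel_measurable M" "Y \<in> borel_measurable M"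
    and le: "AE \<omega> in M. \<bar>X \<omega>\<bar> \<le> \<bar>Y \<omega>\<bar>"
  shows "snorm X \<le> snorm Y"
proof -
  have "abs_cdf Y t \<le> abs_cdf X t" for t
    unfolding abs_cdf_def using le by (intro finite_measure_mono_AE) (auto elim!: eventually_mono)
  then show ?thesis
    unfolding snorm_layer_cake[OF assms(1)] snorm_layer_cake[OF assms(2)]
    by (intro nn_integral_mono mult_right_mono ennreal_leI tail_mass_antimono) auto
qed

lemma snorm_indicator:
  assumes [measurable]: "A \<in> events"
  shows "snorm (indicator A) = ennreal (H (1 - prob A))"
proof -
  have "snorm (indicator A) = (\<integral>\<^sup>+t. ennreal (H (1 - prob A)) * indicator {0..<1::real} t \<partial>lborel)"
    unfolding snorm_layer_cake[OF borel_measurable_indicator[OF assms]]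
  proof (intro nn_integral_cong)
    fix t :: real
    consider "t < 0" | "0 \<le> t" "t < 1" | "1 \<le> t" by linarith
    then show "ennreal (H (abs_cdf (indicator A) t)) * indicator {0..} t =
        ennreal (H (1 - prob A)) * indicator {0..<1} t"
    proof cases
      case 2
      then have "{\<omega>\<in>space M. \<bar>indicator A \<omega>\<bar> \<le> t} = space M - A"
        by (auto simp: indicator_def split: if_splits)
      then have "abs_cdf (indicator A) t = 1 - prob A" by (simp add: abs_cdf_def prob_compl)
      then show ?thesis using 2 by simp
    next
      case 3
      then have "{\<omega>\<in>space M. \<bar>indicator A \<omega>\<bar> \<le> t} = space M" by (auto simp: indicator_def)
      then have "abs_cdf (indicator A) t = 1" by (simp add: abs_cdf_def prob_space)
      then show ?thesis using 3 by simp
    qed simp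
  qed
  then show ?thesis by (simp add: nn_integral_cmult_indicator)
qed

lemma snorm_0[simp]: "snorm (\<lambda>_. 0) = 0"
  using snorm_indicator[of "{}"] by (simp add: indicator_def[abs_def])

lemma snorm_scale:
  assumes X[measurable]: "X \<in> borel_measurable M"
  shows "snorm (\<lambda>\<omega>. c * X \<omega>) = ennreal \<bar>c\<bar> * snorm X"
proof (cases "c = 0")
  case False
  note [measurable] = borel_measurable_abs_quantile[OF X]
  have "snorm (\<lambda>\<omega>. c * X \<omega>) =
      (\<integral>\<^sup>+u. ennreal \<bar>c\<bar> * (ennreal (dens u) * ennreal (indicator {0<..<1} u * abs_quantile X u)) \<partial>lborel)"
    unfolding snorm_eq
    by (intro nn_integral_cong)
      (auto simp: indicator_def abs_quantile_scale[OF X] False ennreal_mult' ac_simps)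
  also have "\<dots> = ennreal \<bar>c\<bar> * (\<integral>\<^sup>+u. (ennreal (dens u) * ennreal (indicator {0<..<1} u * abs_quantile X u)) \<partial>lborel)"
    by (rule nn_integral_cmult) measurable
  also have "(\<integral>\<^sup>+u. (ennreal (dens u) * ennreal (indicator {0<..<1} u * abs_quantile X u)) \<partial>lborel) = snorm X"
    unfolding snorm_eq by (intro nn_integral_cong) (auto simp: indicator_def)
  finally show ?thesis .
qed simp

text \<open>Superlevel sets of a nondecreasing \<open>\<sigma>\<close> are upper intervals up to an endpoint, and their left end
  \<open>a\<close> does not depend on the random variable. Hence the spectral norm is a mixture of tail
  expectations.\<close>
lemma superlevel_integral:
  assumes s: "0 \<le> s"
  obtains a where "0 \<le> a" "a \<le> 1"
    "\<And>X. (\<integral>\<^sup>+u. ennreal (indicator {0<..<1} u * abs_quantile X u) * indicator {u. s < dens u} u \<partial>lborel)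
      = tail_expectation X a"
proof -
  let ?U = "{u. s < dens u}"
  have U: "?U = {u\<in>{0<..<1}. s < \<sigma> u}" using s by (auto simp: dens_def indicator_def split: if_splits)
  (* The value 1 for an empty superlevel set gives a tail expectation over an empty interval, i.e. 0. *)
  define a where "a = (if ?U = {} then 1 else Inf ?U)"
  have bdd: "bdd_below ?U" unfolding U by (auto intro!: bdd_belowI[of _ 0])
  have a01: "0 \<le> a \<and> a \<le> 1"
  proof (cases "?U = {}")
    case False
    then obtain v where "v \<in> ?U" by blast
    then have "Inf ?U \<le> v" "v < 1" using cInf_lower[OF _ bdd, of v] unfolding U by auto
    moreover have "0 \<le> Inf ?U" using False unfolding U by (intro cInf_greatest) auto
    ultimately show ?thesis using False by (simp add: a_def)
  qed (simp add: a_def)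
  have "u \<in> ?U \<longleftrightarrow> u \<in> {a<..<1}" if "u \<noteq> a" for u
  proof
    assume u: "u \<in> ?U"
    then have "Inf ?U \<le> u" by (rule cInf_lower[OF _ bdd])
    moreover have "a = Inf ?U" using u by (auto simp: a_def)
    ultimately have "a < u" using that by auto
    then show "u \<in> {a<..<1}" using u unfolding U by auto
  next
    assume u: "u \<in> {a<..<1}"
    then have "a \<noteq> 1" by auto
    then have ne: "?U \<noteq> {}" unfolding a_def by argo
    then have "a = Inf ?U" unfolding a_def by (rule if_not_P)
    then have "Inf ?U < u" using u by simp
    then obtain v where v: "v \<in> ?U" "v < u" using cInf_lessD[OF ne] by blast
    then have "s < \<sigma> u" using sigma_mono[of v u] u unfolding U by auto
    then show "u \<in> ?U" using u a01 unfolding U by auto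
  qed
  then have "(\<integral>\<^sup>+u. ennreal (indicator {0<..<1} u * abs_quantile X u) * indicator ?U u \<partial>lborel)
      = tail_expectation X a" for X
    unfolding tail_expectation_def
    using a01 AE_lborel_singleton[of a]
    by (intro nn_integral_cong_AE) (auto elim!: eventually_mono simp: indicator_def)
  with a01 that show ?thesis by blast
qed

text \<open>Layer cake in \<open>\<sigma>\<close> instead of the random variable: on each superlevel set of \<open>\<sigma>\<close> the claim is the
  subadditivity of a tail expectation. The two terms on the right are added under the integral over
  \<open>u\<close>, so that measurability in the level \<open>s\<close> need not be discussed.\<close>
lemma snorm_triangle:
  assumes [measurable]: "X \<in> borel_measurable M" "Y \<in> borel_measurable M"
  shows "snorm (\<lambda>\<omega>. X \<omega> + Y \<omega>) \<le> snorm X + snorm Y"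
proof -
  let ?w = "\<lambda>X u. ennreal (indicator {0<..<1} u * abs_quantile X u)"
  note borel_measurable_abs_quantile[measurable]
  have n: "snorm X = (\<integral>\<^sup>+u. ?w X u * ennreal (dens u - 0) \<partial>lborel)" for X
    unfolding snorm_eq by (intro nn_integral_cong) (auto simp: indicator_def mult.commute)
  have "snorm (\<lambda>\<omega>. X \<omega> + Y \<omega>) =
      (\<integral>\<^sup>+s\<in>{0..}. (\<integral>\<^sup>+u. ?w (\<lambda>\<omega>. X \<omega> + Y \<omega>) u * indicator {u. s < dens u} u \<partial>lborel) \<partial>lborel)"
    unfolding n by (rule layer_cake) (auto intro: lborel.sigma_finite_measure_axioms)
  also have "\<dots> \<le> (\<integral>\<^sup>+s\<in>{0..}. (\<integral>\<^sup>+u. (?w X u + ?w Y u) * indicator {u. s < dens u} u \<partial>lborel) \<partial>lborel)"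
  proof (intro nn_integral_mono)
    fix s :: real
    show "(\<integral>\<^sup>+u. ?w (\<lambda>\<omega>. X \<omega> + Y \<omega>) u * indicator {u. s < dens u} u \<partial>lborel) * indicator {0..} s
        \<le> (\<integral>\<^sup>+u. (?w X u + ?w Y u) * indicator {u. s < dens u} u \<partial>lborel) * indicator {0..} s"
    proof (cases "0 \<le> s")
      case True
      then obtain a where a: "0 \<le> a" "a \<le> 1"
        "\<And>X. (\<integral>\<^sup>+u. ?w X u * indicator {u. s < dens u} u \<partial>lborel) = tail_expectation X a"
        by (rule superlevel_integral) blast
      have "(\<integral>\<^sup>+u. (?w X u + ?w Y u) * indicator {u. s < dens u} u \<partial>lborel) =
          tail_expectation X a + tail_expectation Y a"
        unfolding a(3)[symmetric] ring_distribs by (rule nn_integral_add) measurable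
      then show ?thesis using tail_expectation_add[OF assms a(1,2)] by (simp add: a(3) True)
    qed simp
  qed
  also have "\<dots> = (\<integral>\<^sup>+u. (?w X u + ?w Y u) * ennreal (dens u - 0) \<partial>lborel)"
    by (rule layer_cake[symmetric]) (auto intro: lborel.sigma_finite_measure_axioms)
  also have "\<dots> = snorm X + snorm Y"
    unfolding n ring_distribs by (rule nn_integral_add) measurable
  finally show ?thesis .
qed

lemma expectation_le_snorm:
  assumes X[measurable]: "X \<in> borel_measurable M"
  shows "(\<integral>\<^sup>+\<omega>. ennreal \<bar>X \<omega>\<bar> \<partial>M) \<le> snorm X"
  unfolding snorm_layer_cake[OF X] nn_integral_abs_excess[OF X, of 0, simplified]
  by (intro nn_integral_mono mult_right_mono ennreal_leI tail_mass_ge) auto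

lemma snorm_eq_0_iff:
  assumes X[measurable]: "X \<in> borel_measurable M"
  shows "snorm X = 0 \<longleftrightarrow> (AE \<omega> in M. X \<omega> = 0)"
proof
  assume "snorm X = 0"
  then have "(\<integral>\<^sup>+\<omega>. ennreal \<bar>X \<omega>\<bar> \<partial>M) = 0" using expectation_le_snorm[OF X] by simp
  then show "AE \<omega> in M. X \<omega> = 0" by (subst (asm) nn_integral_0_iff_AE) auto
next
  assume "AE \<omega> in M. X \<omega> = 0"
  then have "snorm X \<le> snorm (\<lambda>_. 0)" by (intro snorm_mono) auto
  then show "snorm X = 0" by simp
qed

text \<open>By dominated convergence on the levels: \<open>P (|X\<^sub>n| > t) \<rightarrow> 0\<close> for each \<open>t > 0\<close>, so
  \<open>H (P (|X\<^sub>n| \<le> t)) \<rightarrow> 0\<close>, and the layers of \<open>Y\<close> form an integrable majorant. It gives the density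
  of simple functions in \<open>L\<^sub>\<sigma>\<close>.\<close>
lemma snorm_dominated_convergence:
  fixes X :: "nat \<Rightarrow> 'a \<Rightarrow> real"
  assumes [measurable]: "\<And>n. X n \<in> borel_measurable M" and Y[measurable]: "Y \<in> borel_measurable M"
    and fin: "snorm Y < \<infinity>"
    and dom: "\<And>n. AE \<omega> in M. \<bar>X n \<omega>\<bar> \<le> \<bar>Y \<omega>\<bar>"
    and lim: "AE \<omega> in M. (\<lambda>n. X n \<omega>) \<longlonglongrightarrow> 0"
  shows "(\<lambda>n. snorm (X n)) \<longlonglongrightarrow> 0"
proof -
  have cdf_lim: "(\<lambda>n. abs_cdf (X n) t) \<longlonglongrightarrow> 1" if t: "0 < t" for t
  proof -
    have "(\<lambda>n. \<integral>\<omega>. indicator {\<omega>\<in>space M. \<bar>X n \<omega>\<bar> \<le> t} \<omega> \<partial>M) \<longlonglongrightarrow> (\<integral>\<omega>. (1::real) \<partial>M)"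
    proof (rule integral_dominated_convergence[where w="\<lambda>_. 1"])
      show "AE \<omega> in M. (\<lambda>n. indicator {\<omega>\<in>space M. \<bar>X n \<omega>\<bar> \<le> t} \<omega>) \<longlonglongrightarrow> (1::real)"
        using lim AE_space
      proof eventually_elim
        case (elim \<omega>)
        have "(\<lambda>n. \<bar>X n \<omega>\<bar>) \<longlonglongrightarrow> 0" using elim(1) by (rule tendsto_rabs_zero)
        then have "eventually (\<lambda>n. \<bar>X n \<omega>\<bar> < t) sequentially" using t by (rule order_tendstoD)
        then show ?case
          using elim(2) by (intro tendsto_eventually) (auto elim!: eventually_mono simp: indicator_def)
      qed
    qed (auto simp: indicator_def)
    then show ?thesis by (simp add: abs_cdf_def prob_space)
  qed
  let ?f = "\<lambda>X t. ennreal (H (abs_cdf X t)) * indicator {0..} t"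
  have "(\<lambda>n. \<integral>\<^sup>+t. ?f (X n) t \<partial>lborel) \<longlonglongrightarrow> (\<integral>\<^sup>+t. 0 \<partial>(lborel::real measure))"
  proof (rule nn_integral_dominated_convergence[where w="?f Y"])
    show "AE t in lborel. ?f (X n) t \<le> ?f Y t" for n
    proof -
      have "abs_cdf Y t \<le> abs_cdf (X n) t" for t
        unfolding abs_cdf_def using dom[of n] by (intro finite_measure_mono_AE) (auto elim!: eventually_mono)
      then show ?thesis by (intro AE_I2 mult_right_mono ennreal_leI tail_mass_antimono) auto
    qed
    show "(\<integral>\<^sup>+t. ?f Y t \<partial>lborel) < \<infinity>" using fin by (simp add: snorm_layer_cake)
    show "AE t in lborel. (\<lambda>n. ?f (X n) t) \<longlonglongrightarrow> 0"
      using AE_lborel_singleton[of 0]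
    proof eventually_elim
      case (elim t)
      show ?case
      proof (cases "0 < t")
        case True
        have "(\<lambda>n. H (abs_cdf (X n) t)) \<longlonglongrightarrow> 0" by (intro tail_mass_tendsto_0 cdf_lim True) simp
        then have "(\<lambda>n. ennreal (H (abs_cdf (X n) t))) \<longlonglongrightarrow> ennreal 0" by (rule tendsto_ennrealI)
        then show ?thesis using True by simp
      qed (use elim in auto)
    qed
  qed auto
  then show ?thesis by (simp add: snorm_layer_cake)
qed

section \<open>The dual norm as a bound on events\<close>

text \<open>The bound of the functional induced by \<open>|Z|\<close>, required on indicators only, since
  \<open>H (1 - P A)\<close> is the norm of the indicator of \<open>A\<close>. It turns out to be equivalent both to the full
  operator bound and to the Average Value-at-Risk condition.\<close>
definition tail_bounded :: "real \<Rightarrow> ('a \<Rightarrow> real) \<Rightarrow> bool" where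
  "tail_bounded c Z \<longleftrightarrow>
    (\<forall>A\<in>events. (\<integral>\<^sup>+\<omega>\<in>A. ennreal \<bar>Z \<omega>\<bar> \<partial>M) \<le> ennreal (c * H (1 - prob A)))"

text \<open>Integrate the bound on the events \<open>{|Y| > t}\<close> over \<open>t\<close>.\<close>
lemma Holder_tail_bounded:
  assumes [measurable]: "Y \<in> borel_measurable M" "Z \<in> borel_measurable M"
    and c: "0 \<le> c" and Z: "tail_bounded c Z"
  shows "(\<integral>\<^sup>+\<omega>. ennreal \<bar>Y \<omega> * Z \<omega>\<bar> \<partial>M) \<le> ennreal c * snorm Y"
proof -
  have "(\<integral>\<^sup>+\<omega>. ennreal \<bar>Y \<omega> * Z \<omega>\<bar> \<partial>M) = (\<integral>\<^sup>+\<omega>. ennreal \<bar>Z \<omega>\<bar> * ennreal (\<bar>Y \<omega>\<bar> - 0) \<partial>M)"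
    by (simp add: abs_mult ennreal_mult' mult.commute)
  also have "\<dots> = (\<integral>\<^sup>+t\<in>{0..}. (\<integral>\<^sup>+\<omega>. ennreal \<bar>Z \<omega>\<bar> * indicator {\<omega>. t < \<bar>Y \<omega>\<bar>} \<omega> \<partial>M) \<partial>lborel)"
    by (rule layer_cake) (auto intro: sigma_finite_measure_axioms)
  also have "\<dots> \<le> (\<integral>\<^sup>+t. ennreal c * (ennreal (H (abs_cdf Y t)) * indicator {0..} t) \<partial>lborel)"
  proof (intro nn_integral_mono)
    fix t :: real
    let ?A = "{\<omega>\<in>space M. t < \<bar>Y \<omega>\<bar>}"
    have "(\<integral>\<^sup>+\<omega>. ennreal \<bar>Z \<omega>\<bar> * indicator {\<omega>. t < \<bar>Y \<omega>\<bar>} \<omega> \<partial>M) = (\<integral>\<^sup>+\<omega>\<in>?A. ennreal \<bar>Z \<omega>\<bar> \<partial>M)"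
      by (intro nn_integral_cong) (auto simp: indicator_def)
    also have "\<dots> \<le> ennreal (c * H (1 - prob ?A))"
      using Z unfolding tail_bounded_def by auto
    also have "1 - prob ?A = abs_cdf Y t" by (simp add: prob_abs_gt)
    finally show "(\<integral>\<^sup>+\<omega>. ennreal \<bar>Z \<omega>\<bar> * indicator {\<omega>. t < \<bar>Y \<omega>\<bar>} \<omega> \<partial>M) * indicator {0..} t
        \<le> ennreal c * (ennreal (H (abs_cdf Y t)) * indicator {0..} t)"
      using c by (auto simp: indicator_def ennreal_mult')
  qed
  also have "\<dots> = ennreal c * snorm Y"
    by (simp add: nn_integral_cmult snorm_layer_cake)
  finally show ?thesis .
qed

text \<open>The points with \<open>|Z| = s\<close> contribute \<open>s\<close> per unit of mass, so it does not matter which of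
  them belong to \<open>A\<close>.\<close>
lemma set_nn_integral_excess:
  assumes [measurable]: "Z \<in> borel_measurable M" "A \<in> events" and s: "0 \<le> s"
    and A: "{\<omega>\<in>space M. s < \<bar>Z \<omega>\<bar>} \<subseteq> A" "A \<subseteq> {\<omega>\<in>space M. s \<le> \<bar>Z \<omega>\<bar>}"
  shows "(\<integral>\<^sup>+\<omega>\<in>A. ennreal \<bar>Z \<omega>\<bar> \<partial>M) =
    ennreal (s * prob A) + (\<integral>\<^sup>+\<omega>. ennreal (\<bar>Z \<omega>\<bar> - s) \<partial>M)"
proof -
  have "(\<integral>\<^sup>+\<omega>\<in>A. ennreal \<bar>Z \<omega>\<bar> \<partial>M) = (\<integral>\<^sup>+\<omega>. ennreal s * indicator A \<omega> + ennreal (\<bar>Z \<omega>\<bar> - s) \<partial>M)"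
  proof (intro nn_integral_cong)
    fix \<omega> assume \<omega>: "\<omega> \<in> space M"
    show "ennreal \<bar>Z \<omega>\<bar> * indicator A \<omega> = ennreal s * indicator A \<omega> + ennreal (\<bar>Z \<omega>\<bar> - s)"
    proof (cases "\<omega> \<in> A")
      case True
      then have "s \<le> \<bar>Z \<omega>\<bar>" using A by auto
      then show ?thesis using True s by (simp add: ennreal_plus[symmetric] del: ennreal_plus)
    next
      case False
      then have "\<bar>Z \<omega>\<bar> - s \<le> 0" using A \<omega> by auto
      then show ?thesis using False by (simp add: ennreal_neg)
    qed
  qed
  also have "\<dots> = ennreal (s * prob A) + (\<integral>\<^sup>+\<omega>. ennreal (\<bar>Z \<omega>\<bar> - s) \<partial>M)"
    using s by (subst nn_integral_add)
      (auto simp: nn_integral_cmult_indicator emeasure_eq_measure ennreal_mult')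
  finally show ?thesis .
qed

text \<open>If \<open>P\<close> has atoms, \<open>a\<close> need not be of the form \<open>1 - P A\<close>. But \<open>a\<close> lies between
  \<open>x = P (|Z| < s)\<close> and \<open>y = P (|Z| \<le> s)\<close> for its quantile \<open>s\<close>; between these points the tail
  expectation is affine, at them it is the mass of \<open>|Z|\<close> on \<open>{|Z| \<ge> s}\<close> and on \<open>{|Z| > s}\<close>, and
  \<open>c H\<close> is concave. So the inequality at \<open>x\<close> and \<open>y\<close> implies the one at \<open>a\<close>.\<close>
lemma tail_expectation_le_of_tail_bounded:
  assumes [measurable]: "Z \<in> borel_measurable M" and c: "0 \<le> c" and Z: "tail_bounded c Z"
    and a: "0 \<le> a" "a < 1"
  shows "tail_expectation Z a \<le> ennreal (c * H a)"
proof -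
  obtain s where s: "0 \<le> s" "prob {\<omega>\<in>space M. \<bar>Z \<omega>\<bar> < s} \<le> a" "a \<le> abs_cdf Z s"
    "tail_expectation Z a = ennreal (s * (1 - a)) + (\<integral>\<^sup>+\<omega>. ennreal (\<bar>Z \<omega>\<bar> - s) \<partial>M)"
    by (rule tail_expectation_attained[OF assms(1) a])
  let ?A = "{\<omega>\<in>space M. s < \<bar>Z \<omega>\<bar>}" and ?B = "{\<omega>\<in>space M. s \<le> \<bar>Z \<omega>\<bar>}"
  define x y where "x = prob {\<omega>\<in>space M. \<bar>Z \<omega>\<bar> < s}" and "y = abs_cdf Z s"
  have xy: "0 \<le> x" "x \<le> a" "a \<le> y" "y \<le> 1" using s by (auto simp: x_def y_def)
  have "?B = space M - {\<omega>\<in>space M. \<bar>Z \<omega>\<bar> < s}" by auto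
  then have B: "prob ?B = 1 - x" unfolding x_def by (simp add: prob_compl)
  have A: "prob ?A = 1 - y" by (simp add: prob_abs_gt y_def)
  have cut: "ennreal (s * prob C) + (\<integral>\<^sup>+\<omega>. ennreal (\<bar>Z \<omega>\<bar> - s) \<partial>M) \<le> ennreal (c * H (1 - prob C))"
    if "C \<in> events" "?A \<subseteq> C" "C \<subseteq> ?B" for C
    using Z that(1) unfolding tail_bounded_def
    by (simp add: set_nn_integral_excess[OF assms(1) that(1) s(1) that(2,3), symmetric])
  have AB: "?A \<subseteq> ?B" by auto
  have A': "ennreal (s * (1 - y)) + (\<integral>\<^sup>+\<omega>. ennreal (\<bar>Z \<omega>\<bar> - s) \<partial>M) \<le> ennreal (c * H y)"
    using cut[OF _ order_refl AB] unfolding A by simp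
  have B': "ennreal (s * (1 - x)) + (\<integral>\<^sup>+\<omega>. ennreal (\<bar>Z \<omega>\<bar> - s) \<partial>M) \<le> ennreal (c * H x)"
    using cut[OF _ AB order_refl] unfolding B by simp
  have "(\<integral>\<^sup>+\<omega>. ennreal (\<bar>Z \<omega>\<bar> - s) \<partial>M) \<noteq> \<top>" using A' by (auto simp: top_unique)
  then obtain e where e: "0 \<le> e" "(\<integral>\<^sup>+\<omega>. ennreal (\<bar>Z \<omega>\<bar> - s) \<partial>M) = ennreal e"
    by (cases "(\<integral>\<^sup>+\<omega>. ennreal (\<bar>Z \<omega>\<bar> - s) \<partial>M)") auto
  have Hnn: "0 \<le> c * H x" "0 \<le> c * H y" "0 \<le> c * H a"
    using c xy a by (auto intro!: mult_nonneg_nonneg tail_mass_nonneg)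
  have nn: "0 \<le> s * (1 - x)" "0 \<le> s * (1 - y)" "0 \<le> s * (1 - a)" using s xy a by auto
  have Ay: "s * (1 - y) + e \<le> c * H y"
    using A' nn e Hnn by (simp add: ennreal_plus[symmetric] del: ennreal_plus)
  have Bx: "s * (1 - x) + e \<le> c * H x"
    using B' nn e Hnn by (simp add: ennreal_plus[symmetric] del: ennreal_plus)
  have Hx: "c * H x \<le> c * (H a - (x - a) * \<sigma> a)" and Hy: "c * H y \<le> c * (H a - (y - a) * \<sigma> a)"
    using tail_mass_supergradient[of a x] tail_mass_supergradient[of a y] c xy a
    by (auto intro!: mult_left_mono)
  (* The affine function has slope -s and the tangent of c H at a has slope - c * \<sigma> a; the
     sign of their difference decides which end point to compare with. *)
  have "s * (1 - a) + e \<le> c * H a"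
  proof (cases "c * \<sigma> a \<le> s")
    case True
    then have "(a - x) * (c * \<sigma> a) \<le> (a - x) * s" using xy by (intro mult_left_mono) auto
    with Bx Hx show ?thesis by (simp add: algebra_simps)
  next
    case False
    then have "(y - a) * s \<le> (y - a) * (c * \<sigma> a)" using xy by (intro mult_left_mono) auto
    with Ay Hy show ?thesis by (simp add: algebra_simps)
  qed
  then show ?thesis using e nn by (simp add: s(4) ennreal_plus[symmetric] ennreal_leI del: ennreal_plus)
qed

lemma avar_le_iff:
  assumes Z: "integrable M Z" and a: "0 \<le> a" "a < 1" and c: "0 \<le> c"
  shows "avar M a (\<lambda>\<omega>. \<bar>Z \<omega>\<bar>) \<le> c / (1 - a) * (LBINT u:{a<..<1}. \<sigma> u) \<longleftrightarrow>
    tail_expectation Z a \<le> ennreal (c * H a)"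
proof -
  have Zm[measurable]: "Z \<in> borel_measurable M" using Z by auto
  note [measurable] = borel_measurable_abs_quantile[OF Zm]
  have "tail_expectation Z a \<le> ennreal (0 * (1 - a)) + (\<integral>\<^sup>+\<omega>. ennreal (\<bar>Z \<omega>\<bar> - 0) \<partial>M)"
    using a by (intro tail_expectation_le) auto
  also have "\<dots> < \<infinity>" using Z by (auto simp: integrable_iff_bounded)
  finally have fin: "tail_expectation Z a < \<infinity>" .
  have eq: "indicator {a<..<1} u *\<^sub>R abs_quantile Z u =
      indicator {a<..} u * (indicator {0<..<1} u * abs_quantile Z u)" for u
    using a by (auto simp: indicator_def)
  have "(LBINT u:{a<..<1}. abs_quantile Z u) = enn2real (\<integral>\<^sup>+u. ennreal (indicator {a<..<1} u *\<^sub>R abs_quantile Z u) \<partial>lborel)"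
    unfolding set_lebesgue_integral_def eq
  proof (intro integral_eq_nn_integral AE_I2)
    show "(\<lambda>u. indicator {a<..} u * (indicator {0<..<1} u * abs_quantile Z u)) \<in> borel_measurable lborel"
      by measurable
  qed (auto simp: indicator_def abs_quantile_nonneg)
  also have "(\<integral>\<^sup>+u. ennreal (indicator {a<..<1} u *\<^sub>R abs_quantile Z u) \<partial>lborel) = tail_expectation Z a"
    unfolding tail_expectation_def by (intro nn_integral_cong) (auto simp: indicator_def)
  finally have "avar M a (\<lambda>\<omega>. \<bar>Z \<omega>\<bar>) = enn2real (tail_expectation Z a) / (1 - a)"
    by (simp add: avar_def abs_quantile_def)
  moreover have "enn2real (tail_expectation Z a) \<le> c * H a \<longleftrightarrow> tail_expectation Z a \<le> ennreal (c * H a)"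
    using fin c a by (cases "tail_expectation Z a") (auto simp: tail_mass_nonneg)
  ultimately show ?thesis using a by (simp add: tail_mass_def divide_le_cancel)
qed

lemma tail_bounded_iff_avar:
  assumes Z: "integrable M Z" and c: "0 \<le> c"
  shows "tail_bounded c Z \<longleftrightarrow>
    (\<forall>\<alpha>\<in>{0..<1}. avar M \<alpha> (\<lambda>\<omega>. \<bar>Z \<omega>\<bar>) \<le> c / (1 - \<alpha>) * (LBINT u:{\<alpha><..<1}. \<sigma> u))"
proof -
  have Zm[measurable]: "Z \<in> borel_measurable M" using Z by auto
  have "tail_bounded c Z" if *: "\<forall>\<alpha>\<in>{0..<1}. tail_expectation Z \<alpha> \<le> ennreal (c * H \<alpha>)"
    unfolding tail_bounded_def
  proof
    fix A assume A: "A \<in> events"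
    show "(\<integral>\<^sup>+\<omega>\<in>A. ennreal \<bar>Z \<omega>\<bar> \<partial>M) \<le> ennreal (c * H (1 - prob A))"
    proof (cases "prob A = 0")
      case True
      then show ?thesis
        using nn_integral_indicator_le_tail_expectation[OF Zm A] by (simp add: tail_expectation_def)
    next
      case False
      then have "1 - prob A \<in> {0..<1}" using zero_less_measure_iff[of M A] by simp
      then show ?thesis
        using * nn_integral_indicator_le_tail_expectation[OF Zm A] by (blast intro: order_trans)
    qed
  qed
  then have "tail_bounded c Z \<longleftrightarrow> (\<forall>\<alpha>\<in>{0..<1}. tail_expectation Z \<alpha> \<le> ennreal (c * H \<alpha>))"
    using tail_expectation_le_of_tail_bounded[OF Zm c] by auto
  also have "\<dots> \<longleftrightarrow>
      (\<forall>\<alpha>\<in>{0..<1}. avar M \<alpha> (\<lambda>\<omega>. \<bar>Z \<omega>\<bar>) \<le> c / (1 - \<alpha>) * (LBINT u:{\<alpha><..<1}. \<sigma> u))"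
    by (intro ball_cong refl avar_le_iff[OF Z _ _ c, symmetric]) auto
  finally show ?thesis .
qed

abbreviation dnorm :: "('a \<Rightarrow> real) \<Rightarrow> ennreal" where "dnorm \<equiv> rv_sigma_dual_norm M \<sigma>"

text \<open>Each of the bounds in \<^const>\<open>tail_bounded\<close> is a closed condition on the constant, so a finite
  infimum in the dual norm is attained. All properties of the dual norm follow from this
  characterisation.\<close>
lemma dnorm_le_iff:
  assumes Z: "integrable M Z" and c: "0 \<le> c"
  shows "dnorm Z \<le> ennreal c \<longleftrightarrow> tail_bounded c Z"
proof -
  have eq: "dnorm Z = Inf (ennreal ` {\<eta>. 0 \<le> \<eta> \<and> tail_bounded \<eta> Z})"
    unfolding rv_sigma_dual_norm_def
    by (intro arg_cong[where f=Inf] arg_cong2[where f=image] Collect_cong conj_cong refl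
      tail_bounded_iff_avar[OF Z, symmetric])
  show ?thesis
  proof
    assume le: "dnorm Z \<le> ennreal c"
    show "tail_bounded c Z" unfolding tail_bounded_def
    proof (rule ballI, rule ennreal_le_epsilon)
      fix A and e :: real assume A: "A \<in> events" and e: "0 < e"
      have "dnorm Z < ennreal (c + e)" using le by (rule le_less_trans) (use e c in \<open>auto intro: ennreal_lessI\<close>)
      then obtain d where d: "0 \<le> d" "tail_bounded d Z" "ennreal d < ennreal (c + e)"
        unfolding eq Inf_less_iff by blast
      then have "d \<le> c + e" by (auto simp: ennreal_less_iff)
      have h: "0 \<le> H (1 - prob A)" "H (1 - prob A) \<le> 1"
        using tail_mass_nonneg[of "1 - prob A"] tail_mass_antimono[of 0 "1 - prob A"] by auto
      have "d * H (1 - prob A) \<le> (c + e) * H (1 - prob A)"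
        using \<open>d \<le> c + e\<close> h by (intro mult_right_mono)
      also have "\<dots> \<le> c * H (1 - prob A) + e"
        using h e mult_left_mono[OF h(2), of e] by (simp add: algebra_simps)
      finally have "ennreal (d * H (1 - prob A)) \<le> ennreal (c * H (1 - prob A) + e)"
        by (rule ennreal_leI)
      moreover have "(\<integral>\<^sup>+\<omega>\<in>A. ennreal \<bar>Z \<omega>\<bar> \<partial>M) \<le> ennreal (d * H (1 - prob A))"
        using d(2) A by (auto simp: tail_bounded_def)
      ultimately show "(\<integral>\<^sup>+\<omega>\<in>A. ennreal \<bar>Z \<omega>\<bar> \<partial>M) \<le> ennreal (c * H (1 - prob A)) + ennreal e"
        using e c h by simp
    qed
  next
    assume "tail_bounded c Z"
    then show "dnorm Z \<le> ennreal c" unfolding eq using c by (intro Inf_lower) simp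
  qed
qed

section \<open>Norm properties and test functions of the dual norm\<close>

lemma tail_bounded_nonneg_factor: "0 \<le> c \<Longrightarrow> 0 \<le> c * H (1 - prob A)"
  by (simp add: tail_mass_nonneg)

lemma tail_bounded_add:
  assumes [measurable]: "Z \<in> borel_measurable M" "W \<in> borel_measurable M"
    and c: "0 \<le> c" "tail_bounded c Z" and d: "0 \<le> d" "tail_bounded d W"
  shows "tail_bounded (c + d) (\<lambda>\<omega>. Z \<omega> + W \<omega>)"
  unfolding tail_bounded_def
proof
  fix A assume A[measurable]: "A \<in> events"
  have "(\<integral>\<^sup>+\<omega>\<in>A. ennreal \<bar>Z \<omega> + W \<omega>\<bar> \<partial>M) \<le>
      (\<integral>\<^sup>+\<omega>. ennreal \<bar>Z \<omega>\<bar> * indicator A \<omega> + ennreal \<bar>W \<omega>\<bar> * indicator A \<omega> \<partial>M)"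
    by (intro nn_integral_mono)
      (auto simp: indicator_def ennreal_plus[symmetric] intro!: ennreal_leI simp del: ennreal_plus)
  also have "\<dots> = (\<integral>\<^sup>+\<omega>\<in>A. ennreal \<bar>Z \<omega>\<bar> \<partial>M) + (\<integral>\<^sup>+\<omega>\<in>A. ennreal \<bar>W \<omega>\<bar> \<partial>M)"
    by (rule nn_integral_add) measurable
  also have "\<dots> \<le> ennreal (c * H (1 - prob A)) + ennreal (d * H (1 - prob A))"
    using c d A by (intro add_mono) (auto simp: tail_bounded_def)
  also have "\<dots> = ennreal ((c + d) * H (1 - prob A))"
    using c d by (simp add: ring_distribs tail_mass_nonneg)
  finally show "(\<integral>\<^sup>+\<omega>\<in>A. ennreal \<bar>Z \<omega> + W \<omega>\<bar> \<partial>M) \<le> \<dots>" .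
qed

lemma tail_bounded_scale:
  assumes [measurable]: "Z \<in> borel_measurable M" and c: "tail_bounded c Z"
  shows "tail_bounded (\<bar>a\<bar> * c) (\<lambda>\<omega>. a * Z \<omega>)"
  unfolding tail_bounded_def
proof
  fix A assume A[measurable]: "A \<in> events"
  have "(\<integral>\<^sup>+\<omega>\<in>A. ennreal \<bar>a * Z \<omega>\<bar> \<partial>M) = (\<integral>\<^sup>+\<omega>. ennreal \<bar>a\<bar> * (ennreal \<bar>Z \<omega>\<bar> * indicator A \<omega>) \<partial>M)"
    by (intro nn_integral_cong) (auto simp: indicator_def abs_mult ennreal_mult')
  also have "\<dots> = ennreal \<bar>a\<bar> * (\<integral>\<^sup>+\<omega>\<in>A. ennreal \<bar>Z \<omega>\<bar> \<partial>M)"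
    by (rule nn_integral_cmult) measurable
  also have "\<dots> \<le> ennreal \<bar>a\<bar> * ennreal (c * H (1 - prob A))"
    using c A by (intro mult_left_mono) (auto simp: tail_bounded_def)
  also have "\<dots> = ennreal (\<bar>a\<bar> * c * H (1 - prob A))"
    by (simp add: ennreal_mult'[symmetric] mult.assoc)
  finally show "(\<integral>\<^sup>+\<omega>\<in>A. ennreal \<bar>a * Z \<omega>\<bar> \<partial>M) \<le> \<dots>" .
qed

lemma tail_bounded_dnorm:
  assumes "integrable M Z" "dnorm Z < \<infinity>"
  obtains c where "0 \<le> c" "dnorm Z = ennreal c" "tail_bounded c Z"
  using assms dnorm_le_iff[OF assms(1)] by (cases "dnorm Z") auto

lemma dnorm_triangle:
  assumes Z: "integrable M Z" "dnorm Z < \<infinity>" and W: "integrable M W" "dnorm W < \<infinity>"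
  shows "dnorm (\<lambda>\<omega>. Z \<omega> + W \<omega>) \<le> dnorm Z + dnorm W"
proof -
  obtain c where c: "0 \<le> c" "dnorm Z = ennreal c" "tail_bounded c Z" by (rule tail_bounded_dnorm[OF Z])
  obtain d where d: "0 \<le> d" "dnorm W = ennreal d" "tail_bounded d W" by (rule tail_bounded_dnorm[OF W])
  have "dnorm (\<lambda>\<omega>. Z \<omega> + W \<omega>) \<le> ennreal (c + d)"
    using Z W c d by (subst dnorm_le_iff) (auto intro!: tail_bounded_add)
  then show ?thesis using c d by simp
qed

lemma dnorm_scale_le:
  assumes Z: "integrable M Z" "dnorm Z < \<infinity>"
  shows "dnorm (\<lambda>\<omega>. a * Z \<omega>) \<le> ennreal \<bar>a\<bar> * dnorm Z"
proof -
  obtain c where c: "0 \<le> c" "dnorm Z = ennreal c" "tail_bounded c Z" by (rule tail_bounded_dnorm[OF Z])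
  have "dnorm (\<lambda>\<omega>. a * Z \<omega>) \<le> ennreal (\<bar>a\<bar> * c)"
    using Z c by (subst dnorm_le_iff) (auto intro!: tail_bounded_scale)
  then show ?thesis using c by (simp add: ennreal_mult')
qed

text \<open>Scaling by \<open>a\<close> and then by \<open>1 / a\<close> turns the inequality into an equality.\<close>
lemma dnorm_scale:
  assumes Z: "integrable M Z" "dnorm Z < \<infinity>"
  shows "dnorm (\<lambda>\<omega>. a * Z \<omega>) = ennreal \<bar>a\<bar> * dnorm Z"
proof (rule antisym[OF dnorm_scale_le[OF Z]])
  show "ennreal \<bar>a\<bar> * dnorm Z \<le> dnorm (\<lambda>\<omega>. a * Z \<omega>)"
  proof (cases "a = 0")
    case False
    have "dnorm (\<lambda>\<omega>. a * Z \<omega>) < \<infinity>"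
      using dnorm_scale_le[OF Z, of a] by (rule le_less_trans) (use Z in \<open>simp add: ennreal_mult_less_top\<close>)
    then have "dnorm (\<lambda>\<omega>. inverse a * (a * Z \<omega>)) \<le> ennreal \<bar>inverse a\<bar> * dnorm (\<lambda>\<omega>. a * Z \<omega>)"
      using Z by (intro dnorm_scale_le) auto
    then have "dnorm Z \<le> ennreal \<bar>inverse a\<bar> * dnorm (\<lambda>\<omega>. a * Z \<omega>)"
      using False by (simp add: mult.assoc[symmetric])
    then have "ennreal \<bar>a\<bar> * dnorm Z \<le> ennreal \<bar>a\<bar> * (ennreal \<bar>inverse a\<bar> * dnorm (\<lambda>\<omega>. a * Z \<omega>))"
      by (rule mult_left_mono) simp
    also have "\<dots> = ennreal (\<bar>a\<bar> * \<bar>inverse a\<bar>) * dnorm (\<lambda>\<omega>. a * Z \<omega>)"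
      by (simp add: ennreal_mult' mult.assoc)
    also have "\<bar>a\<bar> * \<bar>inverse a\<bar> = 1" using False by simp
    also have "ennreal 1 * dnorm (\<lambda>\<omega>. a * Z \<omega>) = dnorm (\<lambda>\<omega>. a * Z \<omega>)" by simp
    finally show ?thesis .
  qed simp
qed

lemma dnorm_eq_0_iff:
  assumes Z: "integrable M Z"
  shows "dnorm Z = 0 \<longleftrightarrow> (AE \<omega> in M. Z \<omega> = 0)"
proof -
  have [measurable]: "Z \<in> borel_measurable M" using Z by auto
  have "dnorm Z = 0 \<longleftrightarrow> tail_bounded 0 Z" using dnorm_le_iff[OF Z, of 0] by simp
  also have "\<dots> \<longleftrightarrow> (AE \<omega> in M. Z \<omega> = 0)"
  proof
    assume "tail_bounded 0 Z"
    then have "(\<integral>\<^sup>+\<omega>\<in>space M. ennreal \<bar>Z \<omega>\<bar> \<partial>M) \<le> ennreal (0 * H (1 - prob (space M)))"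
      unfolding tail_bounded_def by blast
    then have "(\<integral>\<^sup>+\<omega>\<in>space M. ennreal \<bar>Z \<omega>\<bar> \<partial>M) = 0" by simp
    then show "AE \<omega> in M. Z \<omega> = 0"
      by (subst (asm) nn_integral_0_iff_AE) (auto simp: indicator_def)
  next
    assume "AE \<omega> in M. Z \<omega> = 0"
    then have "(\<integral>\<^sup>+\<omega>\<in>A. ennreal \<bar>Z \<omega>\<bar> \<partial>M) = 0" if [measurable]: "A \<in> events" for A
      by (subst nn_integral_0_iff_AE) (auto elim!: eventually_mono)
    then show "tail_bounded 0 Z" by (simp add: tail_bounded_def)
  qed
  finally show ?thesis .
qed

lemma integrable_product:
  assumes [measurable]: "Y \<in> borel_measurable M" "Z \<in> borel_measurable M"
    and "snorm Y < \<infinity>" "0 \<le> c" "tail_bounded c Z"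
  shows "integrable M (\<lambda>\<omega>. Y \<omega> * Z \<omega>)"
  unfolding integrable_iff_bounded
proof
  have "(\<integral>\<^sup>+\<omega>. ennreal \<bar>Y \<omega> * Z \<omega>\<bar> \<partial>M) \<le> ennreal c * snorm Y"
    using assms by (intro Holder_tail_bounded)
  also have "\<dots> < \<infinity>" using assms by (simp add: ennreal_mult_less_top)
  finally show "(\<integral>\<^sup>+\<omega>. ennreal (norm (Y \<omega> * Z \<omega>)) \<partial>M) < \<infinity>" by simp
qed measurable

lemma abs_expectation_product_le:
  assumes [measurable]: "Y \<in> borel_measurable M" "Z \<in> borel_measurable M"
    and "0 \<le> c" "tail_bounded c Z"
  shows "ennreal \<bar>\<integral>\<omega>. Y \<omega> * Z \<omega> \<partial>M\<bar> \<le> ennreal c * snorm Y"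
proof -
  have "ennreal \<bar>\<integral>\<omega>. Y \<omega> * Z \<omega> \<partial>M\<bar> \<le> (\<integral>\<^sup>+\<omega>. ennreal \<bar>Y \<omega> * Z \<omega>\<bar> \<partial>M)"
    using integral_norm_bound_ennreal[of M "\<lambda>\<omega>. Y \<omega> * Z \<omega>"]
    by (cases "integrable M (\<lambda>\<omega>. Y \<omega> * Z \<omega>)") (auto simp: not_integrable_integral_eq)
  also have "\<dots> \<le> ennreal c * snorm Y" using assms by (intro Holder_tail_bounded)
  finally show ?thesis .
qed

text \<open>The test function that recovers the mass of \<open>|Z|\<close> on \<open>A\<close> from the pairing with \<open>Z\<close>, while being
  no larger in absolute value than the indicator of \<open>A\<close>.\<close>
definition sign_test :: "('a \<Rightarrow> real) \<Rightarrow> 'a set \<Rightarrow> 'a \<Rightarrow> real" where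
  "sign_test Z A \<omega> = sgn (Z \<omega>) * indicator A \<omega>"

lemma borel_measurable_sign_test[measurable]:
  assumes [measurable]: "Z \<in> borel_measurable M" "A \<in> events"
  shows "sign_test Z A \<in> borel_measurable M"
  unfolding sign_test_def[abs_def] by measurable

lemma snorm_sign_test_le:
  assumes [measurable]: "Z \<in> borel_measurable M" "A \<in> events"
  shows "snorm (sign_test Z A) \<le> ennreal (H (1 - prob A))"
  unfolding snorm_indicator[OF assms(2), symmetric]
  by (intro snorm_mono) (auto simp: sign_test_def indicator_def abs_sgn_eq)

text \<open>The converse of the Hoelder inequality. It is used for the lower bound of the operator norm and
  for showing that a representing density lies in the dual space.\<close>
lemma tail_bounded_sign_testI:
  assumes Z: "integrable M Z" and c: "0 \<le> c"
    and test: "\<And>A. A \<in> events \<Longrightarrow>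
      ennreal \<bar>\<integral>\<omega>. sign_test Z A \<omega> * Z \<omega> \<partial>M\<bar> \<le> ennreal c * snorm (sign_test Z A)"
  shows "tail_bounded c Z"
  unfolding tail_bounded_def
proof
  fix A assume A[measurable]: "A \<in> events"
  have [measurable]: "Z \<in> borel_measurable M" using Z by auto
  have eq: "sign_test Z A \<omega> * Z \<omega> = \<bar>Z \<omega>\<bar> * indicator A \<omega>" for \<omega>
    by (simp add: sign_test_def indicator_def abs_sgn mult.commute)
  have int: "integrable M (\<lambda>\<omega>. \<bar>Z \<omega>\<bar> * indicator A \<omega>)"
    using Z by (intro integrable_mult_indicator[OF A, of "\<lambda>\<omega>. \<bar>Z \<omega>\<bar>", simplified real_scaleR_def mult.commute]) auto
  have "(\<integral>\<^sup>+\<omega>\<in>A. ennreal \<bar>Z \<omega>\<bar> \<partial>M) = (\<integral>\<^sup>+\<omega>. ennreal (\<bar>Z \<omega>\<bar> * indicator A \<omega>) \<partial>M)"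
    by (intro nn_integral_cong) (auto simp: indicator_def)
  also have "\<dots> = ennreal (\<integral>\<omega>. \<bar>Z \<omega>\<bar> * indicator A \<omega> \<partial>M)"
    by (intro nn_integral_eq_integral int) auto
  also have "\<dots> \<le> ennreal \<bar>\<integral>\<omega>. sign_test Z A \<omega> * Z \<omega> \<partial>M\<bar>"
    unfolding eq by (intro ennreal_leI) auto
  also have "\<dots> \<le> ennreal c * snorm (sign_test Z A)" by (rule test) fact
  also have "\<dots> \<le> ennreal c * ennreal (H (1 - prob A))"
    by (intro mult_left_mono snorm_sign_test_le) auto
  finally show "(\<integral>\<^sup>+\<omega>\<in>A. ennreal \<bar>Z \<omega>\<bar> \<partial>M) \<le> ennreal (c * H (1 - prob A))"
    using c by (simp add: ennreal_mult')
qed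

section \<open>Representation of bounded functionals\<close>

text \<open>Domination by \<open>c H (1 - P A)\<close> gives continuity at the empty set, hence countable additivity, and
  also absolute continuity; so the Radon--Nikodym theorem applies.\<close>
lemma density_of_dominated_additive:
  fixes g :: "'a set \<Rightarrow> real"
  assumes nonneg: "\<And>A. A \<in> events \<Longrightarrow> 0 \<le> g A"
    and add: "\<And>A B. A \<in> events \<Longrightarrow> B \<in> events \<Longrightarrow> A \<inter> B = {} \<Longrightarrow> g (A \<union> B) = g A + g B"
    and dom: "\<And>A. A \<in> events \<Longrightarrow> g A \<le> c * H (1 - prob A)"
  obtains D where "integrable M D" "\<And>A. A \<in> events \<Longrightarrow> (\<integral>\<omega>. indicator A \<omega> * D \<omega> \<partial>M) = g A"
proof -
  let ?g = "\<lambda>A. ennreal (g A)"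
  have null: "g A = 0" if "A \<in> events" "prob A = 0" for A
    using nonneg[OF that(1)] dom[OF that(1)] that(2) by simp
  have pos: "positive events ?g" by (simp add: positive_def null)
  have additive: "Measure_Space.additive events ?g"
    unfolding Measure_Space.additive_def by (intro ballI impI) (simp add: add nonneg)
  have ca: "countably_additive events ?g"
  proof (rule sets.empty_continuous_imp_countably_additive[OF pos additive])
    fix A :: "nat \<Rightarrow> 'a set" assume A: "range A \<subseteq> events" "decseq A" "(\<Inter>i. A i) = {}"
    have "(\<lambda>i. prob (A i)) \<longlonglongrightarrow> 0" using finite_Lim_measure_decseq[OF A(1,2)] A(3) by simp
    then have "(\<lambda>i. 1 - prob (A i)) \<longlonglongrightarrow> 1 - 0" by (intro tendsto_diff tendsto_const)
    then have "(\<lambda>i. c * H (1 - prob (A i))) \<longlonglongrightarrow> c * 0"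
      by (intro tendsto_mult tendsto_const tail_mass_tendsto_0) auto
    then have *: "(\<lambda>i. c * H (1 - prob (A i))) \<longlonglongrightarrow> 0" by simp
    have "A i \<in> events" for i using A(1) by auto
    then have "(\<lambda>i. g (A i)) \<longlonglongrightarrow> 0"
      by (intro tendsto_sandwich[OF _ _ tendsto_const *] always_eventually allI nonneg dom)
    then show "(\<lambda>i. ?g (A i)) \<longlonglongrightarrow> 0" using tendsto_ennrealI[of _ 0] by simp
  qed simp
  define N where "N = measure_of (space M) events ?g"
  have sN: "sets N = events" by (simp add: N_def)
  have eN: "emeasure N A = ennreal (g A)" if "A \<in> events" for A
    unfolding N_def using that pos ca by (intro emeasure_measure_of_sigma sets.sigma_algebra_axioms)
  have fin: "finite_measure N"
    using eN[of "space M"] sets_eq_imp_space_eq[OF sN] by (intro finite_measureI) simp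
  have ac: "absolutely_continuous M N"
    unfolding absolutely_continuous_def
    by (auto simp: null_sets_def sN eN emeasure_eq_measure null)
  obtain D where D[measurable]: "D \<in> borel_measurable M" and RN: "AE x in M. RN_deriv M N x = ennreal (D x)"
    and "AE x in N. 0 < D x" and Dnn: "\<And>x. 0 \<le> D x"
    by (rule real_RN_deriv[OF fin ac sN]) blast
  have nn: "(\<integral>\<^sup>+\<omega>. ennreal (indicator A \<omega> * D \<omega>) \<partial>M) = ennreal (g A)" if A[measurable]: "A \<in> events" for A
  proof -
    have "ennreal (g A) = emeasure (density M (RN_deriv M N)) A"
      using density_RN_deriv[OF ac sN] eN[OF A] by simp
    also have "\<dots> = (\<integral>\<^sup>+\<omega>\<in>A. RN_deriv M N \<omega> \<partial>M)" by (rule emeasure_density) auto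
    also have "\<dots> = (\<integral>\<^sup>+\<omega>. ennreal (indicator A \<omega> * D \<omega>) \<partial>M)"
      using RN by (intro nn_integral_cong_AE) (auto elim!: eventually_mono simp: indicator_def)
    finally show ?thesis ..
  qed
  show ?thesis
  proof
    show "integrable M D"
    proof (rule integrableI_nonneg)
      have "(\<integral>\<^sup>+\<omega>. ennreal (D \<omega>) \<partial>M) = (\<integral>\<^sup>+\<omega>. ennreal (indicator (space M) \<omega> * D \<omega>) \<partial>M)"
        by (intro nn_integral_cong) simp
      then show "(\<integral>\<^sup>+\<omega>. ennreal (D \<omega>) \<partial>M) < \<infinity>" by (simp add: nn)
    qed (simp_all add: Dnn)
    show "(\<integral>\<omega>. indicator A \<omega> * D \<omega> \<partial>M) = g A" if [measurable]: "A \<in> events" for A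
      using that by (subst integral_eq_nn_integral) (auto simp: Dnn nn nonneg)
  qed
qed

text \<open>The Jordan decomposition of a finitely additive \<open>\<nu>\<close>: its positive part
  \<open>p A = sup {\<nu> B | B \<subseteq> A}\<close> is additive and inherits the bound, because \<open>H (1 - P B)\<close> increases with
  \<open>B\<close>; likewise for \<open>p - \<nu>\<close>. Both parts then have densities.\<close>
lemma density_of_dominated_signed:
  fixes \<nu> :: "'a set \<Rightarrow> real"
  assumes add: "\<And>A B. A \<in> events \<Longrightarrow> B \<in> events \<Longrightarrow> A \<inter> B = {} \<Longrightarrow> \<nu> (A \<union> B) = \<nu> A + \<nu> B"
    and c: "0 \<le> c" and dom: "\<And>A. A \<in> events \<Longrightarrow> \<bar>\<nu> A\<bar> \<le> c * H (1 - prob A)"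
  obtains Z where "integrable M Z" "\<And>A. A \<in> events \<Longrightarrow> (\<integral>\<omega>. indicator A \<omega> * Z \<omega> \<partial>M) = \<nu> A"
proof -
  define p where "p A = (SUP B\<in>{B\<in>events. B \<subseteq> A}. \<nu> B)" for A
  have mono: "c * H (1 - prob B) \<le> c * H (1 - prob A)" if "A \<in> events" "B \<subseteq> A" for A B
    using that c by (intro mult_left_mono tail_mass_antimono) (auto intro: finite_measure_mono)
  have bound: "\<nu> B \<le> c * H (1 - prob A)" if "A \<in> events" "B \<in> events" "B \<subseteq> A" for A B
    using dom[OF that(2)] mono[OF that(1,3)] by linarith
  have upper: "\<nu> B \<le> p A" if "A \<in> events" "B \<in> events" "B \<subseteq> A" for A B
    unfolding p_def using that bound[OF that(1)]
    by (intro cSUP_upper bdd_aboveI[of _ "c * H (1 - prob A)"]) auto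
  have least: "p A \<le> x" if "\<And>B. B \<in> events \<Longrightarrow> B \<subseteq> A \<Longrightarrow> \<nu> B \<le> x" for A x
    unfolding p_def using that by (intro cSUP_least) auto
  have \<nu>0: "\<nu> {} = 0" using add[of "{}" "{}"] by simp
  have p_add: "p (A \<union> B) = p A + p B" if A: "A \<in> events" and B: "B \<in> events" and disj: "A \<inter> B = {}" for A B
  proof (rule antisym)
    show "p (A \<union> B) \<le> p A + p B"
    proof (rule least)
      fix C assume C: "C \<in> events" "C \<subseteq> A \<union> B"
      then have "C = (C \<inter> A) \<union> (C \<inter> B)" by auto
      then have "\<nu> C = \<nu> (C \<inter> A) + \<nu> (C \<inter> B)"
        using add[of "C \<inter> A" "C \<inter> B"] A B C disj by auto
      then show "\<nu> C \<le> p A + p B"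
        using upper[of A "C \<inter> A"] upper[of B "C \<inter> B"] A B C by auto
    qed
    have "\<nu> C + \<nu> D \<le> p (A \<union> B)" if "C \<in> events" "C \<subseteq> A" "D \<in> events" "D \<subseteq> B" for C D
    proof -
      have "\<nu> C + \<nu> D = \<nu> (C \<union> D)" using that disj by (intro add[symmetric]) auto
      also have "\<dots> \<le> p (A \<union> B)" using that A B by (intro upper) auto
      finally show ?thesis .
    qed
    then have "p A \<le> p (A \<union> B) - \<nu> D" if "D \<in> events" "D \<subseteq> B" for D
      using that by (intro least) (simp add: algebra_simps)
    then have "p B \<le> p (A \<union> B) - p A"
      by (intro least) (simp add: algebra_simps)
    then show "p A + p B \<le> p (A \<union> B)" by simp
  qed
  have p_dom: "p A \<le> c * H (1 - prob A)" if "A \<in> events" for A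
    by (intro least bound that)
  obtain P where P: "integrable M P" "\<And>A. A \<in> events \<Longrightarrow> (\<integral>\<omega>. indicator A \<omega> * P \<omega> \<partial>M) = p A"
  proof (rule density_of_dominated_additive)
    show "0 \<le> p A" if "A \<in> events" for A using upper[OF that, of "{}"] \<nu>0 by simp
  qed (use p_add p_dom in auto)
  obtain Q where Q: "integrable M Q" "\<And>A. A \<in> events \<Longrightarrow> (\<integral>\<omega>. indicator A \<omega> * Q \<omega> \<partial>M) = p A - \<nu> A"
  proof (rule density_of_dominated_additive[of "\<lambda>A. p A - \<nu> A" "2 * c"])
    show "0 \<le> p A - \<nu> A" if "A \<in> events" for A using upper[OF that that] by simp
    show "p A - \<nu> A \<le> 2 * c * H (1 - prob A)" if "A \<in> events" for A
      using p_dom[OF that] dom[OF that] by linarith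
  qed (use p_add add in auto)
  show ?thesis
  proof
    show "integrable M (\<lambda>\<omega>. P \<omega> - Q \<omega>)" using P Q by simp
    fix A assume A: "A \<in> events"
    have "integrable M (\<lambda>\<omega>. indicator A \<omega> * P \<omega>)" "integrable M (\<lambda>\<omega>. indicator A \<omega> * Q \<omega>)"
      using integrable_mult_indicator[OF A P(1)] integrable_mult_indicator[OF A Q(1)] by simp_all
    then show "(\<integral>\<omega>. indicator A \<omega> * (P \<omega> - Q \<omega>) \<partial>M) = \<nu> A"
      by (simp add: right_diff_distrib P(2)[OF A] Q(2)[OF A])
  qed
qed

text \<open>The density \<open>Z\<close> of \<open>A \<mapsto> \<phi> 1\<^sub>A\<close> represents \<open>\<phi>\<close> on simple functions. The sign tests of \<open>Z\<close> are
  simple, so \<open>Z\<close> satisfies the bound of \<open>\<phi>\<close>; then both sides of the representation are continuous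
  on \<open>L\<^sub>\<sigma>\<close>, and simple functions approximate each element in norm.\<close>
lemma bounded_functional_representation:
  fixes \<phi> :: "('a \<Rightarrow> real) \<Rightarrow> real"
  defines "L \<equiv> {X \<in> borel_measurable M. snorm X < \<infinity>}"
  assumes add: "\<And>X Y. X \<in> L \<Longrightarrow> Y \<in> L \<Longrightarrow> \<phi> (\<lambda>\<omega>. X \<omega> + Y \<omega>) = \<phi> X + \<phi> Y"
    and scale: "\<And>X a. X \<in> L \<Longrightarrow> \<phi> (\<lambda>\<omega>. a * X \<omega>) = a * \<phi> X"
    and c: "0 \<le> c" and bound: "\<And>X. X \<in> L \<Longrightarrow> ennreal \<bar>\<phi> X\<bar> \<le> ennreal c * snorm X"
  obtains Z where "integrable M Z" "tail_bounded c Z" "\<And>X. X \<in> L \<Longrightarrow> \<phi> X = (\<integral>\<omega>. X \<omega> * Z \<omega> \<partial>M)"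
proof -
  have L_add: "(\<lambda>\<omega>. X \<omega> + Y \<omega>) \<in> L" if "X \<in> L" "Y \<in> L" for X Y
    using that snorm_triangle[of X Y] unfolding L_def by (auto intro: le_less_trans)
  have L_scale: "(\<lambda>\<omega>. a * X \<omega>) \<in> L" if "X \<in> L" for X a
    using that unfolding L_def by (auto simp: snorm_scale ennreal_mult_less_top)
  have L_indicator: "indicator A \<in> L" if "A \<in> events" for A
    using that unfolding L_def by (auto simp: snorm_indicator)
  obtain Z where Z: "integrable M Z" and \<nu>: "\<And>A. A \<in> events \<Longrightarrow> (\<integral>\<omega>. indicator A \<omega> * Z \<omega> \<partial>M) = \<phi> (indicator A)"
  proof (rule density_of_dominated_signed[of "\<lambda>A. \<phi> (indicator A)" c])
    fix A B assume A: "A \<in> events" "B \<in> events" "A \<inter> B = {}"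
    have "(indicator (A \<union> B) :: 'a \<Rightarrow> real) = (\<lambda>\<omega>. indicator A \<omega> + indicator B \<omega>)"
      using A(3) by (auto simp: indicator_def fun_eq_iff)
    then show "\<phi> (indicator (A \<union> B)) = \<phi> (indicator A) + \<phi> (indicator B)"
      using add[OF L_indicator[OF A(1)] L_indicator[OF A(2)]] by simp
  next
    fix A assume A: "A \<in> events"
    show "\<bar>\<phi> (indicator A)\<bar> \<le> c * H (1 - prob A)"
      using bound[OF L_indicator[OF A]] c tail_bounded_nonneg_factor[OF c, of A]
      by (simp add: snorm_indicator A ennreal_mult'[symmetric])
  qed (use c in auto)
  have Zm[measurable]: "Z \<in> borel_measurable M" using Z by auto
  have int_ind: "integrable M (\<lambda>\<omega>. indicator A \<omega> * Z \<omega>)" if "A \<in> events" for A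
    using integrable_mult_indicator[OF that Z] by simp
  have step: "(\<lambda>\<omega>. \<Sum>y\<in>S. f y * indicator (A y) \<omega>) \<in> L \<and>
      \<phi> (\<lambda>\<omega>. \<Sum>y\<in>S. f y * indicator (A y) \<omega>) = (\<integral>\<omega>. (\<Sum>y\<in>S. f y * indicator (A y) \<omega>) * Z \<omega> \<partial>M) \<and>
      integrable M (\<lambda>\<omega>. (\<Sum>y\<in>S. f y * indicator (A y) \<omega>) * Z \<omega>)"
    if "finite S" "\<And>y. y \<in> S \<Longrightarrow> A y \<in> events" for S :: "real set" and f A
    using that
  proof (induction S)
    case empty
    have "(\<lambda>_. 0) \<in> L" by (simp add: L_def)
    moreover from this have "\<phi> (\<lambda>_. 0) = 0" using scale[of "\<lambda>_. 0" 0] by simp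
    ultimately show ?case by simp
  next
    case (insert y S)
    define g where "g \<omega> = (\<Sum>y\<in>S. f y * indicator (A y) \<omega>)" for \<omega>
    have IH: "g \<in> L" "\<phi> g = (\<integral>\<omega>. g \<omega> * Z \<omega> \<partial>M)" "integrable M (\<lambda>\<omega>. g \<omega> * Z \<omega>)"
      using insert.IH insert.prems unfolding g_def[abs_def] by blast+
    have g: "(\<Sum>y\<in>insert y S. f y * indicator (A y) \<omega>) = f y * indicator (A y) \<omega> + g \<omega>" for \<omega>
      unfolding g_def by (rule sum.insert[OF insert(1,2)])
    have Ay: "A y \<in> events" using insert by simp
    have t: "(\<lambda>\<omega>. f y * indicator (A y) \<omega>) \<in> L"
      "\<phi> (\<lambda>\<omega>. f y * indicator (A y) \<omega>) = f y * (\<integral>\<omega>. indicator (A y) \<omega> * Z \<omega> \<partial>M)"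
      using L_scale[OF L_indicator[OF Ay]] scale[OF L_indicator[OF Ay]] \<nu>[OF Ay] by auto
    show ?case
      unfolding g using L_add[OF t(1) IH(1)] add[OF t(1) IH(1)] t(2) IH(2,3) int_ind[OF Ay]
      by (simp add: distrib_right mult.assoc)
  qed
  have "tail_bounded c Z"
  proof (rule tail_bounded_sign_testI[OF Z c])
    fix A assume [measurable]: "A \<in> events"
    let ?S = "{-1, 1::real}" and ?A = "\<lambda>y. {\<omega>\<in>space M. sgn (Z \<omega>) = y} \<inter> A"
    have eq: "sign_test Z A \<omega> = (\<Sum>y\<in>?S. y * indicator (?A y) \<omega>)" if "\<omega> \<in> space M" for \<omega>
      using that by (auto simp: sign_test_def indicator_def sgn_if)
    have S: "(\<lambda>\<omega>. \<Sum>y\<in>?S. y * indicator (?A y) \<omega>) \<in> L"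
      "\<phi> (\<lambda>\<omega>. \<Sum>y\<in>?S. y * indicator (?A y) \<omega>) = (\<integral>\<omega>. (\<Sum>y\<in>?S. y * indicator (?A y) \<omega>) * Z \<omega> \<partial>M)"
      using step[of ?S ?A "\<lambda>y. y"] by auto
    have "(\<integral>\<omega>. sign_test Z A \<omega> * Z \<omega> \<partial>M) = (\<integral>\<omega>. (\<Sum>y\<in>?S. y * indicator (?A y) \<omega>) * Z \<omega> \<partial>M)"
      by (intro Bochner_Integration.integral_cong refl) (simp only: eq)
    also have "\<dots> = \<phi> (\<lambda>\<omega>. \<Sum>y\<in>?S. y * indicator (?A y) \<omega>)" by (rule S(2)[symmetric])
    finally have "ennreal \<bar>\<integral>\<omega>. sign_test Z A \<omega> * Z \<omega> \<partial>M\<bar> \<le>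
        ennreal c * snorm (\<lambda>\<omega>. \<Sum>y\<in>?S. y * indicator (?A y) \<omega>)"
      using bound[OF S(1)] by simp
    also have "\<dots> \<le> ennreal c * snorm (sign_test Z A)"
      using S(1) unfolding L_def by (intro mult_left_mono snorm_mono AE_I2) (simp_all only: eq order_refl mem_Collect_eq borel_measurable_sign_test Zm \<open>A \<in> events\<close> zero_le)
    finally show "ennreal \<bar>\<integral>\<omega>. sign_test Z A \<omega> * Z \<omega> \<partial>M\<bar> \<le> \<dots>" .
  qed
  moreover have "\<phi> X = (\<integral>\<omega>. X \<omega> * Z \<omega> \<partial>M)" if X: "X \<in> L" for X
  proof -
    have Xm[measurable]: "X \<in> borel_measurable M" and Xf: "snorm X < \<infinity>" using X by (auto simp: L_def)
    obtain s where s: "\<And>i. simple_function M (s i)"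
      and lim: "\<And>x. x \<in> space M \<Longrightarrow> (\<lambda>i. s i x) \<longlonglongrightarrow> X x"
      and dom: "\<And>i x. x \<in> space M \<Longrightarrow> \<bar>s i x\<bar> \<le> 2 * \<bar>X x\<bar>"
      using borel_measurable_implies_sequence_metric[OF Xm, of 0] unfolding dist_0_norm dist_commute[of _ 0] real_norm_def
      by blast
    (* r i agrees with s i on the space of M; outside of it s i is arbitrary, so that only r i
       is literally a combination of indicators, as the additivity of \<phi> requires. *)
    define r where "r i \<omega> = (\<Sum>y\<in>s i ` space M. y * indicator (s i -` {y} \<inter> space M) \<omega>)" for i \<omega>
    have r_eq: "r i \<omega> = s i \<omega>" if "\<omega> \<in> space M" for i \<omega>
    proof -
      have "r i \<omega> = (\<Sum>y\<in>s i ` space M. if y = s i \<omega> then y else 0)"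
        unfolding r_def using that by (intro sum.cong) (auto simp: indicator_def)
      also have "\<dots> = s i \<omega>" using that s[of i] by (subst sum.delta) (auto simp: simple_function_def)
      finally show ?thesis .
    qed
    have r: "r i \<in> L" "\<phi> (r i) = (\<integral>\<omega>. r i \<omega> * Z \<omega> \<partial>M)" for i
      using step[of "s i ` space M" "\<lambda>y. s i -` {y} \<inter> space M" "\<lambda>y. y"] s[of i]
      unfolding r_def[abs_def] by (auto simp: simple_function_def)
    have rm[measurable]: "r i \<in> borel_measurable M" for i using r(1) by (simp add: L_def)
    have XZ: "integrable M (\<lambda>\<omega>. X \<omega> * Z \<omega>)"
      by (rule integrable_product[OF Xm Zm Xf c]) fact
    have "(\<lambda>i. \<phi> (r i)) \<longlonglongrightarrow> (\<integral>\<omega>. X \<omega> * Z \<omega> \<partial>M)"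
      unfolding r(2)
    proof (rule integral_dominated_convergence[where w="\<lambda>\<omega>. 2 * \<bar>X \<omega> * Z \<omega>\<bar>"])
      show "integrable M (\<lambda>\<omega>. 2 * \<bar>X \<omega> * Z \<omega>\<bar>)" using XZ by auto
      show "AE \<omega> in M. (\<lambda>i. r i \<omega> * Z \<omega>) \<longlonglongrightarrow> X \<omega> * Z \<omega>"
        by (intro AE_I2 tendsto_mult tendsto_const) (simp add: r_eq lim)
      show "AE \<omega> in M. norm (r i \<omega> * Z \<omega>) \<le> 2 * \<bar>X \<omega> * Z \<omega>\<bar>" for i
        by (intro AE_I2) (simp add: r_eq abs_mult mult.assoc[symmetric] mult_right_mono dom)
    qed measurable
    moreover have "(\<lambda>i. \<phi> (r i)) \<longlonglongrightarrow> \<phi> X"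
    proof -
      have d: "(\<lambda>\<omega>. r i \<omega> + (-1) * X \<omega>) \<in> L" "\<phi> (\<lambda>\<omega>. r i \<omega> + (-1) * X \<omega>) = \<phi> (r i) - \<phi> X" for i
      proof -
        show "(\<lambda>\<omega>. r i \<omega> + (-1) * X \<omega>) \<in> L" by (rule L_add[OF r(1) L_scale[OF X]])
        have "\<phi> (\<lambda>\<omega>. r i \<omega> + (-1) * X \<omega>) = \<phi> (r i) + \<phi> (\<lambda>\<omega>. (-1) * X \<omega>)"
          by (rule add[OF r(1) L_scale[OF X]])
        also have "\<phi> (\<lambda>\<omega>. (-1) * X \<omega>) = (-1) * \<phi> X" by (rule scale[OF X])
        finally show "\<phi> (\<lambda>\<omega>. r i \<omega> + (-1) * X \<omega>) = \<phi> (r i) - \<phi> X" by simp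
      qed
      have "(\<lambda>i. snorm (\<lambda>\<omega>. r i \<omega> + (-1) * X \<omega>)) \<longlonglongrightarrow> 0"
      (* |s i| \<le> 2 |X|, hence |s i - X| \<le> 3 |X| *)
      proof (rule snorm_dominated_convergence[where Y="\<lambda>\<omega>. 3 * X \<omega>"])
        show "snorm (\<lambda>\<omega>. 3 * X \<omega>) < \<infinity>" using L_scale[OF X, of 3] by (simp add: L_def)
        show "AE \<omega> in M. \<bar>r i \<omega> + - 1 * X \<omega>\<bar> \<le> \<bar>3 * X \<omega>\<bar>" for i
        proof (rule AE_I2)
          fix \<omega> assume "\<omega> \<in> space M"
          then show "\<bar>r i \<omega> + - 1 * X \<omega>\<bar> \<le> \<bar>3 * X \<omega>\<bar>" using dom[of \<omega> i] r_eq[of \<omega> i] by linarith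
        qed
        show "AE \<omega> in M. (\<lambda>i. r i \<omega> + - 1 * X \<omega>) \<longlonglongrightarrow> 0"
        proof (rule AE_I2)
          fix \<omega> assume \<omega>: "\<omega> \<in> space M"
          have "(\<lambda>i. s i \<omega> + - 1 * X \<omega>) \<longlonglongrightarrow> X \<omega> + - 1 * X \<omega>"
            by (intro tendsto_add tendsto_const lim \<omega>)
          then show "(\<lambda>i. r i \<omega> + - 1 * X \<omega>) \<longlonglongrightarrow> 0" by (simp add: r_eq \<omega>)
        qed
      qed measurable
      then have "(\<lambda>i. ennreal c * snorm (\<lambda>\<omega>. r i \<omega> + (-1) * X \<omega>)) \<longlonglongrightarrow> ennreal c * 0"
        by (intro ennreal_tendsto_cmult) auto
      then have *: "(\<lambda>i. ennreal c * snorm (\<lambda>\<omega>. r i \<omega> + (-1) * X \<omega>)) \<longlonglongrightarrow> 0" by simp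
      have "ennreal \<bar>\<phi> (r i) - \<phi> X\<bar> \<le> ennreal c * snorm (\<lambda>\<omega>. r i \<omega> + (-1) * X \<omega>)" for i
        using bound[OF d(1)[of i]] unfolding d(2) .
      then have "(\<lambda>i. ennreal \<bar>\<phi> (r i) - \<phi> X\<bar>) \<longlonglongrightarrow> 0"
        by (intro tendsto_sandwich[OF _ _ tendsto_const *] always_eventually allI) auto
      then have "(\<lambda>i. ennreal \<bar>\<phi> (r i) - \<phi> X\<bar>) \<longlonglongrightarrow> ennreal 0" by simp
      then have "(\<lambda>i. \<bar>\<phi> (r i) - \<phi> X\<bar>) \<longlonglongrightarrow> 0" by (subst (asm) tendsto_ennreal_iff) auto
      then show ?thesis by (simp add: tendsto_rabs_zero_iff LIM_zero_iff)
    qed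
    ultimately show ?thesis using LIMSEQ_unique by blast
  qed
  ultimately show ?thesis using that Z by blast
qed

section \<open>Almost sure equivalence classes\<close>

lemma ae_class_in_L_sigma_iff:
  "X \<in> borel_measurable M \<Longrightarrow> ae_class M X \<in> L_sigma M \<sigma> \<longleftrightarrow> snorm X < \<infinity>"
  by (auto simp: L_sigma_def L0_space_eq sigma_norm_ae_class)

lemma ae_class_in_L_sigma_star_iff:
  "integrable M Z \<Longrightarrow> ae_class M Z \<in> L_sigma_star M \<sigma> \<longleftrightarrow> dnorm Z < \<infinity>"
  by (auto simp: L_sigma_star_def L1_space_eq sigma_dual_norm_ae_class borel_measurable_integrable)

lemma L_sigma_rep:
  assumes "A \<in> L_sigma M \<sigma>"
  shows "rep A \<in> borel_measurable M" "snorm (rep A) < \<infinity>" "ae_class M (rep A) = A"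
proof -
  obtain X where X: "X \<in> borel_measurable M" "A = ae_class M X"
    using assms by (auto simp: L_sigma_def L0_space_eq)
  then show "rep A \<in> borel_measurable M" "ae_class M (rep A) = A"
    using rep_ae_class[OF X(1)] by (auto simp: ae_class_eq_iff)
  show "snorm (rep A) < \<infinity>" using assms by (simp add: L_sigma_def sigma_norm_def)
qed

lemma L_sigma_star_rep:
  assumes "A \<in> L_sigma_star M \<sigma>"
  shows "integrable M (rep A)" "dnorm (rep A) < \<infinity>" "ae_class M (rep A) = A"
proof -
  obtain X where X: "integrable M X" "A = ae_class M X"
    using assms by (auto simp: L_sigma_star_def L1_space_eq)
  note Xm = borel_measurable_integrable[OF X(1)]
  show "ae_class M (rep A) = A"
    using X rep_ae_class[OF Xm] Xm by (auto simp: ae_class_eq_iff)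
  show "integrable M (rep A)"
    using X(1) unfolding X(2) by (subst integrable_cong_AE[OF rep_ae_class(1)[OF Xm] Xm rep_ae_class(2)[OF Xm]])
  show "dnorm (rep A) < \<infinity>" using assms by (simp add: L_sigma_star_def sigma_dual_norm_def)
qed

lemma L_sigma_cases:
  assumes "A \<in> L_sigma M \<sigma>"
  obtains X where "X \<in> borel_measurable M" "snorm X < \<infinity>" "A = ae_class M X"
  using L_sigma_rep[OF assms] by metis

lemma L_sigma_star_cases:
  assumes "A \<in> L_sigma_star M \<sigma>"
  obtains Z c where "integrable M Z" "Z \<in> borel_measurable M" "0 \<le> c" "dnorm Z = ennreal c" "tail_bounded c Z"
    "A = ae_class M Z"
proof -
  note r = L_sigma_star_rep[OF assms]
  obtain c where "0 \<le> c" "dnorm (rep A) = ennreal c" "tail_bounded c (rep A)"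
    by (rule tail_bounded_dnorm[OF r(1,2)])
  then show ?thesis using r that[of "rep A" c] borel_measurable_integrable[OF r(1)] by simp
qed

lemma class_zero_iff:
  "X \<in> borel_measurable M \<Longrightarrow> ae_class M X = class_zero M \<longleftrightarrow> (AE \<omega> in M. X \<omega> = 0)"
  by (simp add: class_zero_def ae_class_eq_iff)

lemma snorm_add_finite:
  assumes "X \<in> borel_measurable M" "snorm X < \<infinity>" "Y \<in> borel_measurable M" "snorm Y < \<infinity>"
  shows "snorm (\<lambda>\<omega>. X \<omega> + Y \<omega>) < \<infinity>"
  using snorm_triangle[OF assms(1,3)] by (rule le_less_trans) (use assms in simp)

lemma snorm_scale_finite:
  "X \<in> borel_measurable M \<Longrightarrow> snorm X < \<infinity> \<Longrightarrow> snorm (\<lambda>\<omega>. a * X \<omega>) < \<infinity>"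
  by (simp add: snorm_scale ennreal_mult_less_top)

lemma normed_L_sigma: "normed_subspace M (L_sigma M \<sigma>) (sigma_norm M \<sigma>)"
  unfolding normed_subspace_def linear_subspace_def
proof (intro conjI allI ballI)
  show "L_sigma M \<sigma> \<subseteq> L0_space M" by (auto simp: L_sigma_def)
  show "class_zero M \<in> L_sigma M \<sigma>" by (simp add: class_zero_def ae_class_in_L_sigma_iff)
next
  fix A B assume "A \<in> L_sigma M \<sigma>" "B \<in> L_sigma M \<sigma>"
  then obtain X Y where X: "X \<in> borel_measurable M" "snorm X < \<infinity>" "A = ae_class M X"
    and Y: "Y \<in> borel_measurable M" "snorm Y < \<infinity>" "B = ae_class M Y" by (blast elim: L_sigma_cases)
  then show "class_add M A B \<in> L_sigma M \<sigma>"
    and "sigma_norm M \<sigma> (class_add M A B) \<le> sigma_norm M \<sigma> A + sigma_norm M \<sigma> B"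
    by (simp_all add: class_add_ae_class ae_class_in_L_sigma_iff sigma_norm_ae_class snorm_add_finite[simplified] snorm_triangle)
next
  fix c A assume "A \<in> L_sigma M \<sigma>"
  then obtain X where X: "X \<in> borel_measurable M" "snorm X < \<infinity>" "A = ae_class M X" by (blast elim: L_sigma_cases)
  then show "class_scale M c A \<in> L_sigma M \<sigma>"
    and "sigma_norm M \<sigma> (class_scale M c A) = ennreal \<bar>c\<bar> * sigma_norm M \<sigma> A"
    by (simp_all add: class_scale_ae_class ae_class_in_L_sigma_iff sigma_norm_ae_class snorm_scale ennreal_mult_less_top)
next
  fix A assume "A \<in> L_sigma M \<sigma>"
  then obtain X where X: "X \<in> borel_measurable M" "snorm X < \<infinity>" "A = ae_class M X" by (blast elim: L_sigma_cases)
  then show "sigma_norm M \<sigma> A < \<infinity>" "sigma_norm M \<sigma> A = 0 \<longleftrightarrow> A = class_zero M"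
    by (simp_all add: sigma_norm_ae_class snorm_eq_0_iff class_zero_iff)
qed

lemma normed_L_sigma_star: "normed_subspace M (L_sigma_star M \<sigma>) (sigma_dual_norm M \<sigma>)"
  unfolding normed_subspace_def linear_subspace_def
proof (intro conjI allI ballI)
  show "L_sigma_star M \<sigma> \<subseteq> L0_space M"
    by (auto simp: L_sigma_star_def L0_space_eq L1_space_eq borel_measurable_integrable)
  have "dnorm (\<lambda>_. 0) = 0" by (subst dnorm_eq_0_iff) auto
  then show "class_zero M \<in> L_sigma_star M \<sigma>" by (simp add: class_zero_def ae_class_in_L_sigma_star_iff)
next
  fix A B assume "A \<in> L_sigma_star M \<sigma>" "B \<in> L_sigma_star M \<sigma>"
  note a = L_sigma_star_rep[OF this(1)] and b = L_sigma_star_rep[OF this(2)]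
  have m: "rep A \<in> borel_measurable M" "rep B \<in> borel_measurable M" using a b by auto
  have tri: "dnorm (\<lambda>\<omega>. rep A \<omega> + rep B \<omega>) \<le> dnorm (rep A) + dnorm (rep B)"
    by (rule dnorm_triangle[OF a(1,2) b(1,2)])
  have eq: "class_add M A B = ae_class M (\<lambda>\<omega>. rep A \<omega> + rep B \<omega>)" by (simp add: class_add_def)
  show "class_add M A B \<in> L_sigma_star M \<sigma>"
    unfolding eq using a b le_less_trans[OF tri] by (subst ae_class_in_L_sigma_star_iff) auto
  show "sigma_dual_norm M \<sigma> (class_add M A B) \<le> sigma_dual_norm M \<sigma> A + sigma_dual_norm M \<sigma> B"
    unfolding eq using tri m by (simp add: sigma_dual_norm_ae_class) (simp add: sigma_dual_norm_def)
next
  fix c A assume "A \<in> L_sigma_star M \<sigma>"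
  note a = L_sigma_star_rep[OF this]
  have m: "rep A \<in> borel_measurable M" using a by auto
  have eq: "class_scale M c A = ae_class M (\<lambda>\<omega>. c * rep A \<omega>)" by (simp add: class_scale_def)
  show "class_scale M c A \<in> L_sigma_star M \<sigma>"
    unfolding eq using a by (subst ae_class_in_L_sigma_star_iff) (auto simp: dnorm_scale ennreal_mult_less_top)
  show "sigma_dual_norm M \<sigma> (class_scale M c A) = ennreal \<bar>c\<bar> * sigma_dual_norm M \<sigma> A"
    unfolding eq using a m by (simp add: sigma_dual_norm_ae_class dnorm_scale) (simp add: sigma_dual_norm_def)
next
  fix A assume A: "A \<in> L_sigma_star M \<sigma>"
  note a = L_sigma_star_rep[OF this]
  have m: "rep A \<in> borel_measurable M" using a by auto
  show "sigma_dual_norm M \<sigma> A < \<infinity>" using A by (simp add: L_sigma_star_def)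
  have "sigma_dual_norm M \<sigma> A = 0 \<longleftrightarrow> ae_class M (rep A) = class_zero M"
    by (simp add: sigma_dual_norm_def dnorm_eq_0_iff a(1) class_zero_iff m)
  then show "sigma_dual_norm M \<sigma> A = 0 \<longleftrightarrow> A = class_zero M" by (simp add: a(3))
qed

lemma duality_map_ae_class:
  assumes "X \<in> borel_measurable M" "snorm X < \<infinity>" "Z \<in> borel_measurable M"
  shows "duality_map M \<sigma> (ae_class M Z) (ae_class M X) = (\<integral>\<omega>. X \<omega> * Z \<omega> \<partial>M)"
  using assms by (simp add: duality_map_def ae_class_in_L_sigma_iff pairing_ae_class)

lemma duality_map_add:
  assumes "Z \<in> L_sigma_star M \<sigma>" "W \<in> L_sigma_star M \<sigma>" "Y \<in> L_sigma M \<sigma>"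
  shows "duality_map M \<sigma> (class_add M Z W) Y = duality_map M \<sigma> Z Y + duality_map M \<sigma> W Y"
proof -
  obtain z c where z[measurable]: "z \<in> borel_measurable M" and c: "0 \<le> c" "tail_bounded c z" "Z = ae_class M z"
    using assms(1) by (blast elim: L_sigma_star_cases)
  obtain w d where w[measurable]: "w \<in> borel_measurable M" and d: "0 \<le> d" "tail_bounded d w" "W = ae_class M w"
    using assms(2) by (blast elim: L_sigma_star_cases)
  obtain y where y: "y \<in> borel_measurable M" "snorm y < \<infinity>" "Y = ae_class M y"
    using assms(3) by (blast elim: L_sigma_cases)
  have "integrable M (\<lambda>\<omega>. y \<omega> * z \<omega>)" "integrable M (\<lambda>\<omega>. y \<omega> * w \<omega>)"
    using integrable_product[OF y(1) z y(2) c(1,2)] integrable_product[OF y(1) w y(2) d(1,2)] by auto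
  then show ?thesis
    using y(1,2) by (simp add: c(3) d(3) y(3) class_add_ae_class duality_map_ae_class distrib_left)
qed

lemma duality_map_scale:
  assumes "Z \<in> L_sigma_star M \<sigma>" "Y \<in> L_sigma M \<sigma>"
  shows "duality_map M \<sigma> (class_scale M a Z) Y = a * duality_map M \<sigma> Z Y"
proof -
  obtain z where z[measurable]: "z \<in> borel_measurable M" and Z: "Z = ae_class M z"
    using assms(1) by (blast elim: L_sigma_star_cases)
  obtain y where y: "y \<in> borel_measurable M" "snorm y < \<infinity>" "Y = ae_class M y"
    using assms(2) by (blast elim: L_sigma_cases)
  have "(\<integral>\<omega>. y \<omega> * (a * z \<omega>) \<partial>M) = (\<integral>\<omega>. a * (y \<omega> * z \<omega>) \<partial>M)"
    by (simp add: ac_simps)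
  then show ?thesis using y by (simp add: Z y(3) class_scale_ae_class duality_map_ae_class)
qed

lemma class_diff_ae_class:
  assumes [measurable]: "X \<in> borel_measurable M" "Y \<in> borel_measurable M"
  shows "class_diff M (ae_class M X) (ae_class M Y) = ae_class M (\<lambda>\<omega>. X \<omega> + (-1) * Y \<omega>)"
  unfolding class_diff_def class_scale_ae_class[OF assms(2)]
  by (rule class_add_ae_class) measurable

lemma duality_map_in_dual_space:
  assumes "Z \<in> L_sigma_star M \<sigma>"
  shows "duality_map M \<sigma> Z \<in> dual_space M (L_sigma M \<sigma>) (sigma_norm M \<sigma>)"
proof -
  obtain z c where z[measurable]: "z \<in> borel_measurable M" and c: "0 \<le> c" "tail_bounded c z" "Z = ae_class M z"
    using assms by (blast elim: L_sigma_star_cases)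
  have int: "integrable M (\<lambda>\<omega>. X \<omega> * z \<omega>)" if "X \<in> borel_measurable M" "snorm X < \<infinity>" for X
    using integrable_product[OF that(1) z that(2) c(1,2)] .
  have ext: "duality_map M \<sigma> Z \<in> extensional (L_sigma M \<sigma>)" by (simp add: duality_map_def)
  have add: "duality_map M \<sigma> Z (class_add M A B) = duality_map M \<sigma> Z A + duality_map M \<sigma> Z B"
    if "A \<in> L_sigma M \<sigma>" "B \<in> L_sigma M \<sigma>" for A B
  proof -
    obtain X Y where X: "X \<in> borel_measurable M" "snorm X < \<infinity>" "A = ae_class M X"
      and Y: "Y \<in> borel_measurable M" "snorm Y < \<infinity>" "B = ae_class M Y"
      using \<open>A \<in> L_sigma M \<sigma>\<close> \<open>B \<in> L_sigma M \<sigma>\<close> by (blast elim: L_sigma_cases)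
    then show ?thesis
      using int[OF X(1,2)] int[OF Y(1,2)]
      by (simp add: c(3) class_add_ae_class duality_map_ae_class snorm_add_finite[simplified] distrib_right)
  qed
  have scale: "duality_map M \<sigma> Z (class_scale M a A) = a * duality_map M \<sigma> Z A"
    if "A \<in> L_sigma M \<sigma>" for a A
  proof -
    obtain X where X: "X \<in> borel_measurable M" "snorm X < \<infinity>" "A = ae_class M X"
      using \<open>A \<in> L_sigma M \<sigma>\<close> by (blast elim: L_sigma_cases)
    then show ?thesis
      by (simp add: c(3) class_scale_ae_class duality_map_ae_class snorm_scale_finite[simplified] mult.assoc)
  qed
  have "continuous_functional M (L_sigma M \<sigma>) (sigma_norm M \<sigma>) (duality_map M \<sigma> Z)"
    unfolding continuous_functional_def
  proof (intro ballI allI impI)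
    fix A and e :: real assume A: "A \<in> L_sigma M \<sigma>" and e: "0 < e"
    show "\<exists>\<delta>>0. \<forall>B\<in>L_sigma M \<sigma>. sigma_norm M \<sigma> (class_diff M B A) < ennreal \<delta> \<longrightarrow>
        \<bar>duality_map M \<sigma> Z B - duality_map M \<sigma> Z A\<bar> < e"
    proof (intro exI[of _ "e / (c + 1)"] conjI ballI impI)
      show "0 < e / (c + 1)" using e c by simp
      fix B assume B: "B \<in> L_sigma M \<sigma>"
        and small: "sigma_norm M \<sigma> (class_diff M B A) < ennreal (e / (c + 1))"
      obtain X Y where X: "X \<in> borel_measurable M" "snorm X < \<infinity>" "A = ae_class M X"
        and Y: "Y \<in> borel_measurable M" "snorm Y < \<infinity>" "B = ae_class M Y"
        using A B by (blast elim: L_sigma_cases)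
      let ?D = "\<lambda>\<omega>. Y \<omega> + (-1) * X \<omega>"
      have D: "?D \<in> borel_measurable M" using X(1) Y(1) by measurable
      have "snorm ?D < ennreal (e / (c + 1))"
        using small X(1) Y(1) D by (simp only: X(3) Y(3) class_diff_ae_class sigma_norm_ae_class)
      have "ennreal \<bar>\<integral>\<omega>. ?D \<omega> * z \<omega> \<partial>M\<bar> \<le> ennreal c * snorm ?D"
        by (rule abs_expectation_product_le[OF D z c(1,2)])
      also have "\<dots> \<le> ennreal c * ennreal (e / (c + 1))"
        using \<open>snorm ?D < _\<close> by (intro mult_left_mono) auto
      also have "\<dots> = ennreal (c * (e / (c + 1)))" by (rule ennreal_mult'[OF c(1), symmetric])
      finally have "\<bar>\<integral>\<omega>. ?D \<omega> * z \<omega> \<partial>M\<bar> \<le> c * (e / (c + 1))" using c e by simp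
      also have "\<dots> < e" using c e by (simp add: field_simps)
      finally have "\<bar>\<integral>\<omega>. ?D \<omega> * z \<omega> \<partial>M\<bar> < e" .
      moreover have "(\<integral>\<omega>. ?D \<omega> * z \<omega> \<partial>M) = duality_map M \<sigma> Z B - duality_map M \<sigma> Z A"
        using int[OF X(1,2)] int[OF Y(1,2)] X(1,2) Y(1,2)
        by (simp add: X(3) Y(3) c(3) duality_map_ae_class left_diff_distrib)
      ultimately show "\<bar>duality_map M \<sigma> Z B - duality_map M \<sigma> Z A\<bar> < e" by simp
    qed
  qed
  then show ?thesis by (simp add: dual_space_def linear_functionals_def ext add scale)
qed

text \<open>Indicators lie in \<open>L\<^sub>\<sigma>\<close>, and integrals over events determine an integrable density.\<close>
lemma duality_map_inj: "inj_on (duality_map M \<sigma>) (L_sigma_star M \<sigma>)"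
proof (rule inj_onI)
  fix Z W assume Z: "Z \<in> L_sigma_star M \<sigma>" and W: "W \<in> L_sigma_star M \<sigma>"
    and eq: "duality_map M \<sigma> Z = duality_map M \<sigma> W"
  obtain z where z[measurable]: "z \<in> borel_measurable M" "integrable M z" and Z: "Z = ae_class M z"
    using Z by (blast elim: L_sigma_star_cases)
  obtain w where w[measurable]: "w \<in> borel_measurable M" "integrable M w" and W: "W = ae_class M w"
    using W by (blast elim: L_sigma_star_cases)
  have "AE \<omega> in M. z \<omega> = w \<omega>"
  proof (rule density_unique_real)
    fix A assume A[measurable]: "A \<in> events"
    have "snorm (indicator A) < \<infinity>" by (simp add: snorm_indicator)
    then have "duality_map M \<sigma> (ae_class M v) (ae_class M (indicator A)) = (\<integral>\<omega>. indicator A \<omega> * v \<omega> \<partial>M)"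
      if "v \<in> borel_measurable M" for v
      using that by (intro duality_map_ae_class) auto
    then show "(LINT \<omega>:A|M. z \<omega>) = (LINT \<omega>:A|M. w \<omega>)"
      using fun_cong[OF eq, of "ae_class M (indicator A)"] z w
      unfolding Z W set_lebesgue_integral_def by simp
  qed (use z w in auto)
  then show "Z = W" using z w unfolding Z W by (subst ae_class_eq_iff) auto
qed

text \<open>Homogeneity upgrades continuity at zero to a bound: if \<open>|\<psi>| < 1\<close> on the \<open>\<delta>\<close>-ball, the constant
  \<open>1 / \<delta>\<close> works.\<close>
lemma continuous_functional_bounded:
  assumes \<psi>: "\<psi> \<in> dual_space M (L_sigma M \<sigma>) (sigma_norm M \<sigma>)"
  obtains c where "0 \<le> c" "\<And>X. X \<in> borel_measurable M \<Longrightarrow> snorm X < \<infinity> \<Longrightarrow>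
    ennreal \<bar>\<psi> (ae_class M X)\<bar> \<le> ennreal c * snorm X"
proof -
  have scale: "\<psi> (class_scale M a A) = a * \<psi> A" if "A \<in> L_sigma M \<sigma>" for a A
    using \<psi> that by (auto simp: dual_space_def linear_functionals_def)
  have "continuous_functional M (L_sigma M \<sigma>) (sigma_norm M \<sigma>) \<psi>" using \<psi> by (simp add: dual_space_def)
  moreover have z: "class_zero M \<in> L_sigma M \<sigma>" by (simp add: class_zero_def ae_class_in_L_sigma_iff)
  ultimately obtain \<delta> where \<delta>: "0 < \<delta>" and small: "\<And>B. B \<in> L_sigma M \<sigma> \<Longrightarrow>
      sigma_norm M \<sigma> (class_diff M B (class_zero M)) < ennreal \<delta> \<Longrightarrow> \<bar>\<psi> B - \<psi> (class_zero M)\<bar> < 1"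
    unfolding continuous_functional_def using zero_less_one by blast
  have "class_scale M 0 (class_zero M) = class_zero M" by (simp add: class_zero_def class_scale_ae_class)
  then have \<psi>0: "\<psi> (class_zero M) = 0" using scale[OF z, of 0] by simp
  have "ennreal \<bar>\<psi> (ae_class M X)\<bar> \<le> ennreal (1 / \<delta>) * snorm X"
    if X: "X \<in> borel_measurable M" and fin: "snorm X < \<infinity>" for X
  proof -
    obtain n where n: "0 \<le> n" "snorm X = ennreal n" using fin by (cases "snorm X") auto
    have "\<bar>\<psi> (ae_class M X)\<bar> * \<delta> \<le> n"
    (* Rescaling X by \<delta> / m with m > n rather than by \<delta> / n also covers n = 0. *)
    proof (rule dense_ge)
      fix m assume m: "n < m"
      let ?Y = "\<lambda>\<omega>. (\<delta> / m) * X \<omega>"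
      have m0: "0 < m" using m n by simp
      have Y: "?Y \<in> borel_measurable M" "snorm ?Y < \<infinity>" using X snorm_scale_finite[OF X fin] by (simp_all only: borel_measurable_times borel_measurable_const)
      have "snorm ?Y = ennreal (\<delta> / m * n)"
        using m0 \<delta> n by (simp only: snorm_scale[OF X] ennreal_mult' abs_of_pos divide_pos_pos n(2)) (simp add: ennreal_mult'[symmetric])
      also have "\<dots> < ennreal \<delta>" using m m0 \<delta> n by (intro ennreal_lessI) (auto simp: field_simps)
      finally have "sigma_norm M \<sigma> (class_diff M (ae_class M ?Y) (class_zero M)) < ennreal \<delta>"
        using Y(1) by (simp add: class_zero_def class_diff_ae_class sigma_norm_ae_class)
      then have "\<bar>\<psi> (ae_class M ?Y)\<bar> < 1"
        using small[of "ae_class M ?Y"] Y \<psi>0 by (simp only: ae_class_in_L_sigma_iff) simp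
      moreover have "\<psi> (ae_class M ?Y) = \<delta> / m * \<psi> (ae_class M X)"
        using scale[of "ae_class M X" "\<delta> / m"] X fin
        by (simp only: class_scale_ae_class ae_class_in_L_sigma_iff)
      ultimately have "\<delta> / m * \<bar>\<psi> (ae_class M X)\<bar> < 1"
        using m0 \<delta> by (simp only: abs_mult abs_of_pos divide_pos_pos)
      then show "\<bar>\<psi> (ae_class M X)\<bar> * \<delta> \<le> m"
        using m0 by (simp add: field_simps)
    qed
    then have "\<bar>\<psi> (ae_class M X)\<bar> \<le> 1 / \<delta> * n" using \<delta> by (simp add: field_simps)
    then have "ennreal \<bar>\<psi> (ae_class M X)\<bar> \<le> ennreal (1 / \<delta> * n)" by (rule ennreal_leI)
    then show ?thesis using \<delta> n by (simp only: ennreal_mult' n(2) less_imp_le zero_le_divide_1_iff)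
  qed
  moreover have "0 \<le> 1 / \<delta>" using \<delta> by simp
  ultimately show ?thesis using that by blast
qed

lemma duality_map_surj:
  assumes \<psi>: "\<psi> \<in> dual_space M (L_sigma M \<sigma>) (sigma_norm M \<sigma>)"
  shows "\<exists>Z\<in>L_sigma_star M \<sigma>. duality_map M \<sigma> Z = \<psi>"
proof -
  have ext: "\<psi> \<in> extensional (L_sigma M \<sigma>)"
    and add: "\<And>A B. A \<in> L_sigma M \<sigma> \<Longrightarrow> B \<in> L_sigma M \<sigma> \<Longrightarrow> \<psi> (class_add M A B) = \<psi> A + \<psi> B"
    and scale: "\<And>a A. A \<in> L_sigma M \<sigma> \<Longrightarrow> \<psi> (class_scale M a A) = a * \<psi> A"
    using \<psi> by (auto simp: dual_space_def linear_functionals_def)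
  obtain c where c: "0 \<le> c" and bound: "\<And>X. X \<in> borel_measurable M \<Longrightarrow> snorm X < \<infinity> \<Longrightarrow>
    ennreal \<bar>\<psi> (ae_class M X)\<bar> \<le> ennreal c * snorm X"
    by (rule continuous_functional_bounded[OF \<psi>]) blast
  obtain Z where Z: "integrable M Z" "tail_bounded c Z"
    and rep: "\<And>X. X \<in> {X \<in> borel_measurable M. snorm X < \<infinity>} \<Longrightarrow> \<psi> (ae_class M X) = (\<integral>\<omega>. X \<omega> * Z \<omega> \<partial>M)"
  proof (rule bounded_functional_representation[of "\<lambda>X. \<psi> (ae_class M X)" c])
    fix X Y assume "X \<in> {X \<in> borel_measurable M. snorm X < \<infinity>}" "Y \<in> {X \<in> borel_measurable M. snorm X < \<infinity>}"
    then show "\<psi> (ae_class M (\<lambda>\<omega>. X \<omega> + Y \<omega>)) = \<psi> (ae_class M X) + \<psi> (ae_class M Y)"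
      using add[of "ae_class M X" "ae_class M Y"] by (auto simp: class_add_ae_class ae_class_in_L_sigma_iff)
  next
    fix X a assume "X \<in> {X \<in> borel_measurable M. snorm X < \<infinity>}"
    then show "\<psi> (ae_class M (\<lambda>\<omega>. a * X \<omega>)) = a * \<psi> (ae_class M X)"
      using scale[of "ae_class M X" a] by (auto simp: class_scale_ae_class ae_class_in_L_sigma_iff)
  qed (use c bound in auto)
  have "dnorm Z \<le> ennreal c" using Z c by (simp add: dnorm_le_iff)
  then have "dnorm Z < \<infinity>" by (rule le_less_trans) simp
  then have star: "ae_class M Z \<in> L_sigma_star M \<sigma>" using Z(1) by (simp add: ae_class_in_L_sigma_star_iff)
  have "duality_map M \<sigma> (ae_class M Z) = \<psi>"
  proof (rule extensionalityI[OF _ ext])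
    show "duality_map M \<sigma> (ae_class M Z) \<in> extensional (L_sigma M \<sigma>)" by (simp add: duality_map_def)
    fix A assume "A \<in> L_sigma M \<sigma>"
    then obtain X where X: "X \<in> borel_measurable M" "snorm X < \<infinity>" "A = ae_class M X" by (blast elim: L_sigma_cases)
    then show "duality_map M \<sigma> (ae_class M Z) A = \<psi> A"
      using rep[of X] Z(1) by (simp add: duality_map_ae_class borel_measurable_integrable)
  qed
  with star show ?thesis by blast
qed

text \<open>The upper bound is the Hoelder inequality. For the lower bound, a finite operator norm \<open>r\<close> bounds
  the pairing with the normalised sign tests of \<open>z\<close>, hence bounds the dual norm of \<open>z\<close>.\<close>
lemma operator_norm_duality_map:
  assumes "Z \<in> L_sigma_star M \<sigma>"
  shows "operator_norm (L_sigma M \<sigma>) (sigma_norm M \<sigma>) (duality_map M \<sigma> Z) = sigma_dual_norm M \<sigma> Z"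
proof -
  obtain z c where z: "integrable M z" and zm[measurable]: "z \<in> borel_measurable M"
    and c: "0 \<le> c" "dnorm z = ennreal c" "tail_bounded c z" "Z = ae_class M z"
    using assms by (blast elim: L_sigma_star_cases)
  let ?o = "operator_norm (L_sigma M \<sigma>) (sigma_norm M \<sigma>) (duality_map M \<sigma> Z)"
  have upper: "ennreal \<bar>\<integral>\<omega>. X \<omega> * z \<omega> \<partial>M\<bar> \<le> ?o" if X: "X \<in> borel_measurable M" "snorm X \<le> 1" for X
  proof -
    have fin: "snorm X < \<infinity>" using X(2) by (rule le_less_trans) simp
    have "ae_class M X \<in> {A \<in> L_sigma M \<sigma>. sigma_norm M \<sigma> A \<le> 1}"
      using X fin by (simp add: ae_class_in_L_sigma_iff sigma_norm_ae_class)
    then have "ennreal \<bar>duality_map M \<sigma> Z (ae_class M X)\<bar> \<le> ?o"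
      unfolding operator_norm_def by (rule SUP_upper)
    then show ?thesis using X(1) fin by (simp add: c(4) duality_map_ae_class)
  qed
  have "?o \<le> ennreal c"
    unfolding operator_norm_def
  proof (rule SUP_least)
    fix A assume A: "A \<in> {A \<in> L_sigma M \<sigma>. sigma_norm M \<sigma> A \<le> 1}"
    then obtain X where X: "X \<in> borel_measurable M" "snorm X < \<infinity>" "A = ae_class M X" by (blast elim: L_sigma_cases)
    have "snorm X \<le> 1" using A X by (simp add: sigma_norm_ae_class)
    then have "ennreal c * snorm X \<le> ennreal c * 1" by (rule mult_left_mono) simp
    then show "ennreal \<bar>duality_map M \<sigma> Z A\<bar> \<le> ennreal c"
      using abs_expectation_product_le[OF X(1) zm c(1,3)] X
      by (simp add: c(4) duality_map_ae_class)
  qed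
  moreover have "ennreal c \<le> ?o"
  proof (cases ?o)
    case (real r)
    have "tail_bounded r z"
    proof (rule tail_bounded_sign_testI[OF z real(1)])
      fix A assume A[measurable]: "A \<in> events"
      let ?X = "sign_test z A"
      have "snorm ?X < \<infinity>" using snorm_sign_test_le[OF zm A] by (rule le_less_trans) simp
      then obtain n where n: "0 \<le> n" "snorm ?X = ennreal n" by (cases "snorm ?X") auto
      show "ennreal \<bar>\<integral>\<omega>. ?X \<omega> * z \<omega> \<partial>M\<bar> \<le> ennreal r * snorm ?X"
      proof (cases "n = 0")
        case True
        then show ?thesis
          using abs_expectation_product_le[of ?X z c] c n by simp
      next
        case False
        with n have n0: "0 < n" by simp
        have "snorm (\<lambda>\<omega>. (1 / n) * ?X \<omega>) = ennreal \<bar>1 / n\<bar> * ennreal n"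
          by (simp only: snorm_scale[OF borel_measurable_sign_test[OF zm A]] n(2))
        also have "\<dots> = ennreal (\<bar>1 / n\<bar> * n)" by (simp only: ennreal_mult' abs_ge_zero)
        also have "\<bar>1 / n\<bar> * n = 1" using n0 by simp
        finally have "snorm (\<lambda>\<omega>. (1 / n) * ?X \<omega>) = 1" by simp
        then have "ennreal \<bar>\<integral>\<omega>. (1 / n) * ?X \<omega> * z \<omega> \<partial>M\<bar> \<le> ennreal r"
          using n0 upper[of "\<lambda>\<omega>. (1 / n) * ?X \<omega>"] real(2) by simp
        then have "\<bar>\<integral>\<omega>. ?X \<omega> * z \<omega> \<partial>M\<bar> / n \<le> r"
          using n0 real(1) by (simp add: mult.assoc abs_mult)
        then show ?thesis
          using n0 real(1) n by (simp add: ennreal_mult'[symmetric] field_simps ennreal_leI)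
      qed
    qed
    then have "dnorm z \<le> ennreal r" using z real(1) by (simp add: dnorm_le_iff)
    then show ?thesis by (simp add: c(2) real(2))
  qed simp
  ultimately show ?thesis using c(2,4) by (simp add: sigma_dual_norm_ae_class)
qed

end

theorem theorem29:
  fixes M :: "'a measure" and \<sigma> :: "real \<Rightarrow> real"
  assumes "prob_space M"
    and "spectral_function \<sigma>"
  shows "normed_subspace M (L_sigma M \<sigma>) (sigma_norm M \<sigma>) \<and>
    normed_subspace M (L_sigma_star M \<sigma>) (sigma_dual_norm M \<sigma>) \<and>
    (\<forall>Y\<in>L_sigma M \<sigma>. \<forall>Z\<in>L_sigma_star M \<sigma>. integrable M (\<lambda>\<omega>. rep Y \<omega> * rep Z \<omega>)) \<and>
    (\<forall>Z\<in>L_sigma_star M \<sigma>. \<forall>W\<in>L_sigma_star M \<sigma>. \<forall>Y\<in>L_sigma M \<sigma>.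
       duality_map M \<sigma> (class_add M Z W) Y = duality_map M \<sigma> Z Y + duality_map M \<sigma> W Y) \<and>
    (\<forall>c. \<forall>Z\<in>L_sigma_star M \<sigma>. \<forall>Y\<in>L_sigma M \<sigma>.
       duality_map M \<sigma> (class_scale M c Z) Y = c * duality_map M \<sigma> Z Y) \<and>
    bij_betw (duality_map M \<sigma>) (L_sigma_star M \<sigma>)
      (dual_space M (L_sigma M \<sigma>) (sigma_norm M \<sigma>)) \<and>
    (\<forall>Z\<in>L_sigma_star M \<sigma>.
       operator_norm (L_sigma M \<sigma>) (sigma_norm M \<sigma>) (duality_map M \<sigma> Z) = sigma_dual_norm M \<sigma> Z)"
proof -
  interpret spectral_prob M \<sigma>
    using assms by (simp add: spectral_prob_def spectral_def)
  have int: "integrable M (\<lambda>\<omega>. rep Y \<omega> * rep Z \<omega>)"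
    if Y: "Y \<in> L_sigma M \<sigma>" and Z: "Z \<in> L_sigma_star M \<sigma>" for Y Z
  proof -
    note y = L_sigma_rep[OF Y] and z = L_sigma_star_rep[OF Z]
    obtain c where "0 \<le> c" "tail_bounded c (rep Z)" by (rule tail_bounded_dnorm[OF z(1,2)])
    then show ?thesis by (rule integrable_product[OF y(1) borel_measurable_integrable[OF z(1)] y(2)])
  qed
  have "bij_betw (duality_map M \<sigma>) (L_sigma_star M \<sigma>) (dual_space M (L_sigma M \<sigma>) (sigma_norm M \<sigma>))"
    unfolding bij_betw_def
  proof
    show "duality_map M \<sigma> ` L_sigma_star M \<sigma> = dual_space M (L_sigma M \<sigma>) (sigma_norm M \<sigma>)"
      using duality_map_in_dual_space duality_map_surj by blast
  qed (rule duality_map_inj)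
  then show ?thesis
    by (intro conjI ballI allI normed_L_sigma normed_L_sigma_star int duality_map_add
      duality_map_scale operator_norm_duality_map)
qed

end
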